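(* Let $\mathbb{K}$ be a field. There exist quotients of exterior algebras over $\mathbb{K}$ that are LG-quadratic but not G-quadratic.
   Context: $E=\bigwedge_{\mathbb{K}}\langle e_1,\ldots,e_n\rangle$ denotes an exterior algebra, graded by $\deg e_i = 1$; quotients are by graded ideals. Regular sequence: a linear form $\ell$ is regular on a graded module $M$ if $\{m \in M \mid \ell m = 0\} = \ell M$. A sequence $\ell_1,\ldots,\ell_r$ of linear forms is a regular sequence on $M$ if $\ell_i$ is regular on $M/(\ell_1,\ldots,\ell_{i-1})M$ for each $i$. Monomial orders and initial ideals: a monomial of $E$ is a product $e_{i_1}\cdots e_{i_t}$ with $i_1<\cdots<i_t$; a monomial order is a total order on monomials with $1$ smallest and such that $u<v$ implies $uw<vw$ (up to sign) whenever both products are nonzero. $LT(f)$ denotes the leading term of $f$, $in_<(J) = (LT(f) : f \in J)$, and a Gröbner basis of $J$ is a finite set of elements of $J$ whose leading terms generate $in_<(J)$. G-quadratic: $A=E/J$ ($J$ a graded ideal) is G-quadratic if, with respect to some choice of coordinates (basis) of $E_1$ and some monomial order on $E$, $J$ has a Gröbner basis consisting of quadrics (homogeneous elements of degree 2). LG-quadratic: a quotient $R$ of an exterior algebra is LG-quadratic if there exist a G-quadratic quotient $A$ of an exterior algebra and a sequence of linear forms $\ell_1,\ldots,\ell_r$ that is regular on $A$ such that $R \cong A/(\ell_1,\ldots,\ell_r)$ as graded $\mathbb{K}$-algebras. *)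

theory Defs
  imports "HOL-Algebra.QuotRing"
begin

(* An element of the exterior algebra on e_0, ..., e_(n-1) is its coefficient function on the
   standard monomials: f S is the coefficient of e_S, the product of the e_i with i in S taken
   in increasing order. *)
type_synonym 'k ext = "nat set \<Rightarrow> 'k"

(* e_S * e_T = ext_sign S T * e_(S Un T) for disjoint finite S and T:
   the exponent is the number of inversions of the concatenation of S and T. *)
definition ext_sign :: "nat set \<Rightarrow> nat set \<Rightarrow> 'k::field" where
  "ext_sign S T = (- 1) ^ card {(i, j). i \<in> S \<and> j \<in> T \<and> j < i}"

definition ext_mult :: "'k::field ext \<Rightarrow> 'k ext \<Rightarrow> 'k ext" where
  "ext_mult f g = (\<lambda>S. \<Sum>T\<in>Pow S. ext_sign T (S - T) * f T * g (S - T))"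

definition ext_const :: "'k::field \<Rightarrow> 'k ext" where
  "ext_const c = (\<lambda>S. if S = {} then c else 0)"

definition ext_alg :: "nat \<Rightarrow> 'k::field ext ring" where
  "ext_alg n =
    \<lparr>carrier = {f. \<forall>S. f S \<noteq> 0 \<longrightarrow> S \<subseteq> {..<n}},
     mult = ext_mult,
     one = ext_const 1,
     zero = (\<lambda>S. 0),
     add = (\<lambda>f g S. f S + g S)\<rparr>"

definition ext_comp :: "nat \<Rightarrow> nat \<Rightarrow> 'k::field ext set" where
  "ext_comp n d = {f \<in> carrier (ext_alg n). \<forall>S. f S \<noteq> 0 \<longrightarrow> card S = d}"

definition graded_ideal :: "nat \<Rightarrow> 'k::field ext set \<Rightarrow> bool" where
  "graded_ideal n J \<longleftrightarrow>
    ideal J (ext_alg n) \<and> (\<forall>f\<in>J. \<forall>d. (\<lambda>S. if card S = d then f S else 0) \<in> J)"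

abbreviation ext_quot :: "nat \<Rightarrow> 'k::field ext set \<Rightarrow> 'k ext set ring" where
  "ext_quot n J \<equiv> ext_alg n Quot J"

abbreviation ext_class :: "nat \<Rightarrow> 'k::field ext set \<Rightarrow> 'k ext \<Rightarrow> 'k ext set" where
  "ext_class n J f \<equiv> a_r_coset (ext_alg n) J f"

(* A ring isomorphism that maps the class of each scalar to the class of the same scalar is
   the same thing as an isomorphism of algebras over the field. *)
definition graded_alg_iso :: "nat \<Rightarrow> 'k::field ext set \<Rightarrow> nat \<Rightarrow> 'k ext set \<Rightarrow> bool" where
  "graded_alg_iso n J m I \<longleftrightarrow>
    (\<exists>\<phi> \<in> ring_iso (ext_quot n J) (ext_quot m I).
      (\<forall>c. \<phi> (ext_class n J (ext_const c)) = ext_class m I (ext_const c)) \<and>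
      (\<forall>d. \<phi> ` (ext_class n J ` ext_comp n d) = ext_class m I ` ext_comp m d))"

(* The module on which regularity is tested is the quotient by the ideal I. *)
definition regular_form :: "nat \<Rightarrow> 'k::field ext set \<Rightarrow> 'k ext \<Rightarrow> bool" where
  "regular_form n I l \<longleftrightarrow>
    {m \<in> carrier (ext_quot n I). ext_class n I l \<otimes>\<^bsub>ext_quot n I\<^esub> m = \<zero>\<^bsub>ext_quot n I\<^esub>}
    = (\<lambda>m. ext_class n I l \<otimes>\<^bsub>ext_quot n I\<^esub> m) ` carrier (ext_quot n I)"

(* For A = E/I, the quotient A/(l_1, ..., l_i)A is E/(I + (l_1, ..., l_i)). *)
definition regular_sequence :: "nat \<Rightarrow> 'k::field ext set \<Rightarrow> 'k ext list \<Rightarrow> bool" where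
  "regular_sequence n I ls \<longleftrightarrow>
    set ls \<subseteq> ext_comp n 1 \<and>
    (\<forall>i<length ls. regular_form n (Idl\<^bsub>ext_alg n\<^esub> (I \<union> set (take i ls))) (ls ! i))"

(* b 0, ..., b (n - 1) is a basis of the space of linear forms. *)
definition coordinates :: "nat \<Rightarrow> (nat \<Rightarrow> 'k::field ext) \<Rightarrow> bool" where
  "coordinates n b \<longleftrightarrow>
    (\<forall>i<n. b i \<in> ext_comp n 1) \<and>
    (\<forall>f \<in> ext_comp n 1. \<exists>!c. (\<forall>i\<ge>n. c i = 0) \<and> f = (\<lambda>S. \<Sum>i<n. c i * b i S))"

definition coord_monomial :: "nat \<Rightarrow> (nat \<Rightarrow> 'k::field ext) \<Rightarrow> nat set \<Rightarrow> 'k ext" where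
  "coord_monomial n b S =
    foldr (\<lambda>i f. b i \<otimes>\<^bsub>ext_alg n\<^esub> f) (sorted_list_of_set S) \<one>\<^bsub>ext_alg n\<^esub>"

(* Monomials are identified with their index sets; (S, T) \<in> r means that the monomial of S is
   smaller than or equal to that of T. Up to sign, the product of the monomials of S and U is the
   monomial of S Un U if S and U are disjoint, and it is zero otherwise. *)
definition monomial_order :: "nat \<Rightarrow> (nat set \<times> nat set) set \<Rightarrow> bool" where
  "monomial_order n r \<longleftrightarrow>
    linear_order_on (Pow {..<n}) r \<and>
    (\<forall>S \<in> Pow {..<n}. ({}, S) \<in> r) \<and>
    (\<forall>S \<in> Pow {..<n}. \<forall>T \<in> Pow {..<n}. \<forall>U \<in> Pow {..<n}.
      (S, T) \<in> r \<and> S \<noteq> T \<and> S \<inter> U = {} \<and> T \<inter> U = {} \<longrightarrow>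
      (S \<union> U, T \<union> U) \<in> r \<and> S \<union> U \<noteq> T \<union> U)"

(* t is the leading term (coefficient included) of f in the coordinates b.
   The element f = 0 has no leading term. *)
definition leading_term ::
  "nat \<Rightarrow> (nat \<Rightarrow> 'k::field ext) \<Rightarrow> (nat set \<times> nat set) set \<Rightarrow> 'k ext \<Rightarrow> 'k ext \<Rightarrow> bool" where
  "leading_term n b r f t \<longleftrightarrow>
    (\<exists>c M. f = (\<lambda>U. \<Sum>S\<in>Pow {..<n}. c S * coord_monomial n b S U) \<and>
      M \<subseteq> {..<n} \<and> c M \<noteq> 0 \<and> (\<forall>S \<in> Pow {..<n}. c S \<noteq> 0 \<longrightarrow> (S, M) \<in> r) \<and>
      t = (\<lambda>U. c M * coord_monomial n b M U))"

definition lt_ideal ::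
  "nat \<Rightarrow> (nat \<Rightarrow> 'k::field ext) \<Rightarrow> (nat set \<times> nat set) set \<Rightarrow> 'k ext set \<Rightarrow> 'k ext set" where
  "lt_ideal n b r F = Idl\<^bsub>ext_alg n\<^esub> {t. \<exists>f\<in>F. leading_term n b r f t}"

definition groebner_basis ::
  "nat \<Rightarrow> (nat \<Rightarrow> 'k::field ext) \<Rightarrow> (nat set \<times> nat set) set \<Rightarrow> 'k ext set \<Rightarrow> 'k ext set \<Rightarrow> bool" where
  "groebner_basis n b r J G \<longleftrightarrow> finite G \<and> G \<subseteq> J \<and> lt_ideal n b r G = lt_ideal n b r J"

definition G_quadratic :: "nat \<Rightarrow> 'k::field ext set \<Rightarrow> bool" where
  "G_quadratic n J \<longleftrightarrow>
    graded_ideal n J \<and>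
    (\<exists>b r G. coordinates n b \<and> monomial_order n r \<and> groebner_basis n b r J G \<and>
      G \<subseteq> ext_comp n 2)"

definition LG_quadratic :: "nat \<Rightarrow> 'k::field ext set \<Rightarrow> bool" where
  "LG_quadratic n J \<longleftrightarrow>
    graded_ideal n J \<and>
    (\<exists>m I ls. G_quadratic m I \<and> regular_sequence m I ls \<and>
      graded_alg_iso n J m (Idl\<^bsub>ext_alg m\<^esub> (I \<union> set ls)))"

end

(* Let A be the quotient of the exterior algebra on e_0, ..., e_6 by the edge ideal of the path
   0 - 1 - ... - 6. It is defined by quadratic monomials, and l = e_0 + e_3 + e_6 is regular on A:
   every independent set of the other vertices leaves one of 0, 3, 6 without neighbours, and
   contracting with that variable gives a homotopy for multiplication by l. The quotient R of A by l
   is an algebra on six generators with Hilbert series 1 + 6t + 9t^2 + t^3. If R were G-quadratic,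
   an initial ideal would be generated by quadratic monomials, hence be the edge ideal of the
   complement of a graph with six vertices, nine edges and exactly one triangle. No such graph
   exists: each vertex outside the triangle sends at most one edge into it, and the three vertices
   outside span at most two edges, which makes at most eight edges. *)

theory Submission
  imports Complex_Main Defs "HOL-Library.Function_Algebras" "HOL-Library.Nat_Bijection"
begin

text \<open>The difficulty is that coordinates and monomial order are arbitrary. It is met by
  looking only at degrees 2 and 3, where the ideal of R has a simple shape. Its cubic piece is a
  hyperplane, the kernel of the functional reading one coefficient; whatever the coordinates and the
  order, the one standard cubic is the smallest coordinate monomial on which this functional does
  not vanish. Its quadratic piece is only bounded from above, by six spanning quadrics, which leaves
  at least 15 - 6 = 9 standard quadratic monomials. The form is supported on 0, 3, 6 because their
  closed neighbourhoods {0, 1}, {2, 3, 4}, {5, 6} partition the path. Independent sets of the path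
  are counted by 1 + 7t + 15t^2 + 10t^3 + t^4, and slicing by a regular form divides this by 1 + t.
  In seven variables the ideal of R contains the form itself, and an ideal with nonzero linear
  elements fails to be G-quadratic for a trivial reason. Hence e_6 is eliminated, and the absence of
  linear elements is proved as well.\<close>

definition ext_scale :: "'k::field \<Rightarrow> 'k ext \<Rightarrow> 'k ext" where
  "ext_scale c f = (\<lambda>S. c * f S)"

definition ext_mono :: "nat set \<Rightarrow> 'k::field ext" where
  "ext_mono S = (\<lambda>T. if T = S then 1 else 0)"

lemma ext_scale_apply [simp]: "ext_scale c f S = c * f S"
  by (simp add: ext_scale_def)

global_interpretation ext_vs: vector_space "ext_scale :: 'k::field \<Rightarrow> 'k ext \<Rightarrow> 'k ext"
  by standard (simp_all add: fun_eq_iff algebra_simps)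

lemma sum_fun_apply: "(\<Sum>i\<in>A. F i) x = (\<Sum>i\<in>A. F i x)" for F :: "'a \<Rightarrow> 'b \<Rightarrow> 'c::comm_monoid_add"
  by (induction A rule: infinite_finite_induct) auto

text \<open>Replaces the record operations by the pointwise ones of the function type, so that
  additive arithmetic is left to type classes.\<close>

lemma ext_alg_simps [simp]:
  "mult (ext_alg n) = ext_mult"
  "one (ext_alg n) = ext_const 1"
  "zero (ext_alg n) = 0"
  "add (ext_alg n) = (+)"
  by (auto simp: ext_alg_def fun_eq_iff)

lemma carrier_ext_alg: "carrier (ext_alg n) = {f. \<forall>S. f S \<noteq> 0 \<longrightarrow> S \<subseteq> {..<n}}"
  by (simp add: ext_alg_def)

lemma ext_const_eq: "ext_const c = ext_scale c (ext_mono {})"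
  by (auto simp: ext_const_def ext_mono_def fun_eq_iff)

subsection \<open>The ring structure\<close>

text \<open>The defining sum ranges over the infinite set \<open>Pow S\<close> and takes its default
  value. Identities between products thus have content at finite sets only.\<close>

lemma ext_mult_infinite [simp]: "infinite S \<Longrightarrow> ext_mult f g S = 0"
  by (simp add: ext_mult_def finite_Pow_iff)

lemma ext_mult_add_left: "ext_mult (f + g) h = ext_mult f h + ext_mult g h"
  and ext_mult_add_right: "ext_mult h (f + g) = ext_mult h f + ext_mult h g"
  and ext_mult_scale_left: "ext_mult (ext_scale c f) h = ext_scale c (ext_mult f h)"
  and ext_mult_scale_right: "ext_mult h (ext_scale c f) = ext_scale c (ext_mult h f)"
  and ext_mult_zero_left [simp]: "ext_mult 0 h = 0"
  and ext_mult_zero_right [simp]: "ext_mult h 0 = 0"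
  by (auto simp: ext_mult_def fun_eq_iff algebra_simps sum.distrib sum_distrib_left intro!: sum.cong)

lemma finite_inversions: "finite S \<Longrightarrow> finite T \<Longrightarrow> finite {(i, j). i \<in> S \<and> j \<in> T \<and> j < (i::nat)}"
  by (rule finite_subset[of _ "S \<times> T"]) auto

text \<open>Inversions split along a disjoint union, so signs multiply. With its mirror image this
  is the sign identity behind associativity.\<close>

lemma ext_sign_Un_left:
  assumes "finite S" "finite T" "finite U" "S \<inter> T = {}"
  shows "ext_sign (S \<union> T) U = (ext_sign S U * ext_sign T U :: 'k::field)"
proof -
  have "{(i, j). i \<in> S \<union> T \<and> j \<in> U \<and> j < i} =
    {(i, j). i \<in> S \<and> j \<in> U \<and> j < i} \<union> {(i, j). i \<in> T \<and> j \<in> U \<and> j < i}" by auto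
  moreover have "{(i, j). i \<in> S \<and> j \<in> U \<and> j < i} \<inter> {(i, j). i \<in> T \<and> j \<in> U \<and> j < i} = {}"
    using assms by auto
  ultimately show ?thesis
    using assms by (simp add: ext_sign_def card_Un_disjoint finite_inversions power_add)
qed

lemma ext_sign_Un_right:
  assumes "finite S" "finite T" "finite U" "T \<inter> U = {}"
  shows "ext_sign S (T \<union> U) = (ext_sign S T * ext_sign S U :: 'k::field)"
proof -
  have "{(i, j). i \<in> S \<and> j \<in> T \<union> U \<and> j < i} =
    {(i, j). i \<in> S \<and> j \<in> T \<and> j < i} \<union> {(i, j). i \<in> S \<and> j \<in> U \<and> j < i}" by auto
  moreover have "{(i, j). i \<in> S \<and> j \<in> T \<and> j < i} \<inter> {(i, j). i \<in> S \<and> j \<in> U \<and> j < i} = {}"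
    using assms by auto
  ultimately show ?thesis
    using assms by (simp add: ext_sign_def card_Un_disjoint finite_inversions power_add)
qed

lemma ext_sign_empty [simp]: "ext_sign {} S = 1" "ext_sign S {} = 1"
  by (simp_all add: ext_sign_def)

lemma ext_mult_one_left:
  assumes "f \<in> carrier (ext_alg n)"
  shows "ext_mult (ext_const 1) f = f"
proof
  fix S
  show "ext_mult (ext_const 1) f S = f S"
  proof (cases "finite S")
    case True
    have "ext_mult (ext_const 1) f S = (\<Sum>T\<in>{{}}. ext_sign T (S - T) * ext_const 1 T * f (S - T))"
      unfolding ext_mult_def by (rule sum.mono_neutral_right) (use True in \<open>auto simp: ext_const_def\<close>)
    then show ?thesis by (simp add: ext_const_def)
  next
    case False
    then show ?thesis using assms by (auto simp: carrier_ext_alg intro: finite_subset)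
  qed
qed

lemma ext_mult_one_right:
  assumes "f \<in> carrier (ext_alg n)"
  shows "ext_mult f (ext_const 1) = f"
proof
  fix S
  show "ext_mult f (ext_const 1) S = f S"
  proof (cases "finite S")
    case True
    have "ext_mult f (ext_const 1) S = (\<Sum>T\<in>{S}. ext_sign T (S - T) * f T * ext_const 1 (S - T))"
      unfolding ext_mult_def by (rule sum.mono_neutral_right) (use True in \<open>auto simp: ext_const_def\<close>)
    then show ?thesis by (simp add: ext_const_def)
  next
    case False
    then show ?thesis using assms by (auto simp: carrier_ext_alg intro: finite_subset)
  qed
qed

lemma ext_mult_assoc: "ext_mult (ext_mult f g) h = ext_mult f (ext_mult g h)"
proof
  fix S :: "nat set"
  show "ext_mult (ext_mult f g) h S = ext_mult f (ext_mult g h) S"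
  proof (cases "finite S")
    case fin: True
    have "ext_mult (ext_mult f g) h S = (\<Sum>T\<in>Pow S. \<Sum>U\<in>Pow T.
        ext_sign T (S - T) * ext_sign U (T - U) * f U * g (T - U) * h (S - T))"
      by (simp add: ext_mult_def sum_distrib_left sum_distrib_right mult.assoc)
    also have "\<dots> = (\<Sum>(T, U)\<in>Sigma (Pow S) Pow.
        ext_sign T (S - T) * ext_sign U (T - U) * f U * g (T - U) * h (S - T))"
      using fin by (subst sum.Sigma) (auto intro: finite_subset)
    \<comment> \<open>A chain U \<subseteq> T \<subseteq> S is an ordered partition of S into U, T -
      U and S - T. In these terms both bracketings carry the product of the three pairwise
      signs.\<close>
    also have "\<dots> = (\<Sum>(U, V)\<in>Sigma (Pow S) (\<lambda>U. Pow (S - U)).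
        ext_sign U (S - U) * ext_sign V (S - U - V) * f U * g V * h (S - U - V))"
    proof (rule sum.reindex_bij_witness[of _ "\<lambda>(U, V). (U \<union> V, U)" "\<lambda>(T, U). (U, T - U)"], goal_cases)
      case (5 p)
      then obtain T U where p: "p = (T, U)" "U \<subseteq> T" "T \<subseteq> S" by auto
      then have f: "finite T" "finite U" using fin by (auto intro: finite_subset)
      have 1: "ext_sign (U \<union> (T - U)) (S - T) = (ext_sign U (S - T) * ext_sign (T - U) (S - T) :: 'a)"
        using f fin by (intro ext_sign_Un_left) auto
      have 2: "ext_sign U ((T - U) \<union> (S - T)) = (ext_sign U (T - U) * ext_sign U (S - T) :: 'a)"
        using f fin by (intro ext_sign_Un_right) auto
      have "U \<union> (T - U) = T" "(T - U) \<union> (S - T) = S - U" "S - U - (T - U) = S - T" using p by auto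
      then show ?case using 1 2 p by simp
    qed auto
    also have "\<dots> = (\<Sum>U\<in>Pow S. \<Sum>V\<in>Pow (S - U).
        ext_sign U (S - U) * ext_sign V (S - U - V) * f U * g V * h (S - U - V))"
      using fin by (subst sum.Sigma) (auto intro: finite_subset)
    also have "\<dots> = ext_mult f (ext_mult g h) S"
      by (simp add: ext_mult_def sum_distrib_left ac_simps)
    finally show ?thesis .
  qed simp
qed

lemma ext_mult_closed:
  assumes "f \<in> carrier (ext_alg n)" "g \<in> carrier (ext_alg n)"
  shows "ext_mult f g \<in> carrier (ext_alg n)"
  unfolding carrier_ext_alg mem_Collect_eq
proof (intro allI impI)
  fix S assume "ext_mult f g S \<noteq> 0"
  then obtain T where "T \<in> Pow S" "ext_sign T (S - T) * f T * g (S - T) \<noteq> 0"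
    unfolding ext_mult_def by (rule sum.not_neutral_contains_not_neutral)
  then have "T \<subseteq> {..<n}" "S - T \<subseteq> {..<n}" using assms by (auto simp: carrier_ext_alg)
  then show "S \<subseteq> {..<n}" by auto
qed

lemma carrier_ext_algI: "(\<And>S. f S \<noteq> 0 \<Longrightarrow> S \<subseteq> {..<n}) \<Longrightarrow> f \<in> carrier (ext_alg n)"
  and carrier_ext_algD: "f \<in> carrier (ext_alg n) \<Longrightarrow> f S \<noteq> 0 \<Longrightarrow> S \<subseteq> {..<n}"
  by (auto simp: carrier_ext_alg)

lemma carrier_ext_alg_zero [simp]: "0 \<in> carrier (ext_alg n)"
  and carrier_ext_alg_scale: "f \<in> carrier (ext_alg n) \<Longrightarrow> ext_scale c f \<in> carrier (ext_alg n)"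
  and carrier_ext_alg_uminus: "f \<in> carrier (ext_alg n) \<Longrightarrow> - f \<in> carrier (ext_alg n)"
  and carrier_ext_alg_const [simp]: "ext_const c \<in> carrier (ext_alg n)"
  by (auto simp: carrier_ext_alg ext_const_def split: if_splits)

lemma carrier_ext_alg_add:
  assumes "f \<in> carrier (ext_alg n)" "g \<in> carrier (ext_alg n)"
  shows "f + g \<in> carrier (ext_alg n)"
proof (rule carrier_ext_algI)
  fix S assume "(f + g) S \<noteq> 0"
  then have "f S \<noteq> 0 \<or> g S \<noteq> 0" by auto
  then show "S \<subseteq> {..<n}" using assms by (auto dest: carrier_ext_algD)
qed

lemma carrier_ext_alg_diff:
  "f \<in> carrier (ext_alg n) \<Longrightarrow> g \<in> carrier (ext_alg n) \<Longrightarrow> f - g \<in> carrier (ext_alg n)"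
  using carrier_ext_alg_add[of f n "- g"] carrier_ext_alg_uminus[of g n] by simp

lemma ring_ext_alg: "ring (ext_alg n :: 'k::field ext ring)"
proof (intro ringI abelian_groupI monoidI)
  show "\<And>x. x \<in> carrier (ext_alg n) \<Longrightarrow>
    \<exists>y\<in>carrier (ext_alg n). y \<oplus>\<^bsub>ext_alg n\<^esub> x = \<zero>\<^bsub>(ext_alg n :: 'k ext ring)\<^esub>"
    by (rule_tac x = "- x" in bexI) (auto simp: carrier_ext_alg_uminus)
qed (auto simp: ext_mult_closed ext_mult_assoc ext_mult_one_left ext_mult_one_right ext_mult_add_left
    ext_mult_add_right add.assoc add.commute carrier_ext_alg_add)

section \<open>Graded components and monomials\<close>

lemma ext_comp_iff: "f \<in> ext_comp n d \<longleftrightarrow> (\<forall>S. f S \<noteq> 0 \<longrightarrow> S \<subseteq> {..<n} \<and> card S = d)"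
  by (auto simp: ext_comp_def carrier_ext_alg)

lemma ext_comp_carrier: "f \<in> ext_comp n d \<Longrightarrow> f \<in> carrier (ext_alg n)"
  by (simp add: ext_comp_def)

lemma ext_comp_scale: "f \<in> ext_comp n d \<Longrightarrow> ext_scale c f \<in> ext_comp n d"
  by (simp add: ext_comp_iff)

lemma ext_comp_add:
  assumes "f \<in> ext_comp n d" "g \<in> ext_comp n d"
  shows "f + g \<in> ext_comp n d"
  unfolding ext_comp_iff
proof (intro allI impI)
  fix S assume "(f + g) S \<noteq> 0"
  then have "f S \<noteq> 0 \<or> g S \<noteq> 0" by auto
  then show "S \<subseteq> {..<n} \<and> card S = d" using assms by (auto simp: ext_comp_iff)
qed

lemma ext_mono_comp: "S \<subseteq> {..<n} \<Longrightarrow> ext_mono S \<in> ext_comp n (card S)"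
  by (auto simp: ext_comp_iff ext_mono_def split: if_splits)

lemma ext_mono_mult:
  assumes "finite S" "finite T"
  shows "ext_mult (ext_mono S) (ext_mono T) =
    (if S \<inter> T = {} then ext_scale (ext_sign S T) (ext_mono (S \<union> T)) else (0 :: 'k::field ext))"
proof
  fix U
  show "ext_mult (ext_mono S) (ext_mono T) U =
    (if S \<inter> T = {} then ext_scale (ext_sign S T) (ext_mono (S \<union> T)) else (0 :: 'k ext)) U"
  proof (cases "finite U")
    case False
    then show ?thesis using assms by (auto simp: ext_mono_def)
  next
    case True
    have "ext_mult (ext_mono S) (ext_mono T) U =
      (\<Sum>V\<in>Pow U. if V = S then ext_sign S (U - S) * ext_mono T (U - S) else (0 :: 'k))"
      unfolding ext_mult_def by (rule sum.cong) (auto simp: ext_mono_def)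
    also have "\<dots> = (if S \<subseteq> U \<and> U - S = T then ext_sign S T else 0)"
      using True by (auto simp: ext_mono_def)
    also have "S \<subseteq> U \<and> U - S = T \<longleftrightarrow> S \<inter> T = {} \<and> U = S \<union> T" by auto
    finally show ?thesis by (auto simp: ext_mono_def)
  qed
qed

lemma ext_sign_nonzero [simp]: "ext_sign S T \<noteq> (0 :: 'k::field)"
  by (simp add: ext_sign_def)

lemma ext_sign_square [simp]: "ext_sign S T * ext_sign S T = (1 :: 'k::field)"
  by (simp add: ext_sign_def flip: power_mult_distrib)

lemma ext_sign_single: "ext_sign {j} S = ((- 1) ^ card {i \<in> S. i < j} :: 'k::field)"
proof -
  have "{(i, k). i \<in> {j} \<and> k \<in> S \<and> k < i} = Pair j ` {i \<in> S. i < j}" by auto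
  then show ?thesis by (simp add: ext_sign_def card_image inj_on_def)
qed

text \<open>The elements of \<open>S\<close> below \<open>j\<close> and those above \<open>j\<close>
  add up to \<open>card S\<close>, the number of transpositions that carry e_j across e_S.\<close>

lemma ext_sign_single_right:
  assumes "finite S" "j \<notin> S"
  shows "ext_sign S {j} = ((- 1) ^ card S * ext_sign {j} S :: 'k::field)"
proof -
  have "{(i, k). i \<in> S \<and> k \<in> {j} \<and> k < i} = (\<lambda>i. (i, j)) ` {i \<in> S. j < i}" by auto
  then have 1: "ext_sign S {j} = ((- 1) ^ card {i \<in> S. j < i} :: 'k)"
    by (simp add: ext_sign_def card_image inj_on_def)
  have "S = {i \<in> S. i < j} \<union> {i \<in> S. j < i}"
    using assms nat_neq_iff by blast
  then have "card S = card ({i \<in> S. i < j} \<union> {i \<in> S. j < i})" by simp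
  also have "\<dots> = card {i \<in> S. i < j} + card {i \<in> S. j < i}"
    using assms by (intro card_Un_disjoint) auto
  finally show ?thesis
    by (simp add: 1 ext_sign_single power_add flip: power_mult_distrib)
qed

section \<open>Multiplication by linear forms\<close>

lemma sum_Pow_singletons:
  assumes "finite S" "\<And>T. T \<subseteq> S \<Longrightarrow> card T \<noteq> 1 \<Longrightarrow> F T = 0"
  shows "(\<Sum>T\<in>Pow S. F T) = (\<Sum>j\<in>S. F {j})"
proof -
  have "(\<Sum>T\<in>Pow S. F T) = (\<Sum>T\<in>(\<lambda>j. {j}) ` S. F T)"
    by (rule sum.mono_neutral_right) (use assms in \<open>auto simp: card_1_singleton_iff\<close>)
  then show ?thesis by (simp add: sum.reindex)
qed

lemma linear_mult:
  assumes "l \<in> ext_comp n 1" "finite S"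
  shows "ext_mult l g S = (\<Sum>j\<in>S. l {j} * ext_sign {j} (S - {j}) * g (S - {j}))"
  unfolding ext_mult_def using assms
  by (subst sum_Pow_singletons) (auto simp: ext_comp_iff ac_simps)

text \<open>The grade involution, the algebra automorphism that negates every linear form.\<close>

definition ext_inv :: "'k::field ext \<Rightarrow> 'k ext" where
  "ext_inv g = (\<lambda>S. (- 1) ^ card S * g S)"

lemma ext_inv_carrier: "g \<in> carrier (ext_alg n) \<Longrightarrow> ext_inv g \<in> carrier (ext_alg n)"
  by (auto simp: carrier_ext_alg ext_inv_def)

text \<open>Passing a linear form through a monomial costs one sign per factor. This is what later
  makes the set of left multiples of \<open>l\<close> a two-sided ideal.\<close>

lemma mult_linear:
  assumes "l \<in> ext_comp n 1"
  shows "ext_mult g l = ext_mult l (ext_inv g)"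
proof
  fix S
  show "ext_mult g l S = ext_mult l (ext_inv g) S"
  proof (cases "finite S")
    case fin: True
    have "ext_mult g l S = (\<Sum>T\<in>Pow S. ext_sign (S - T) T * g (S - T) * l T)"
      unfolding ext_mult_def
      by (rule sum.reindex_bij_witness[of _ "\<lambda>T. S - T" "\<lambda>T. S - T"]) (auto simp: double_diff)
    also have "\<dots> = (\<Sum>j\<in>S. ext_sign (S - {j}) {j} * g (S - {j}) * l {j})"
      using fin assms by (subst sum_Pow_singletons) (auto simp: ext_comp_iff)
    also have "\<dots> = ext_mult l (ext_inv g) S"
      using fin by (auto simp: linear_mult[OF assms fin] ext_inv_def ext_sign_single_right intro!: sum.cong)
    finally show ?thesis .
  qed simp
qed

lemma linear_anticommute:
  assumes "l \<in> ext_comp n 1" "m \<in> ext_comp n 1"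
  shows "ext_mult m l = - ext_mult l m"
proof -
  have "ext_inv m = - m"
  proof
    fix S show "ext_inv m S = (- m) S"
      using assms(2) by (cases "m S = 0") (auto simp: ext_inv_def ext_comp_iff)
  qed
  also have "- m = ext_scale (- 1) m" by (simp add: fun_eq_iff)
  finally have "ext_mult m l = ext_mult l (ext_scale (- 1) m)"
    using mult_linear[OF assms(1), of m] by simp
  also have "\<dots> = - ext_mult l m" by (simp only: ext_mult_scale_right) (simp add: fun_eq_iff)
  finally show ?thesis .
qed

text \<open>Anticommutativity alone yields 2 l l = 0, which says nothing in characteristic 2.
  Instead the two summands of the coefficient at each pair are seen to cancel.\<close>

lemma linear_square:
  assumes "l \<in> ext_comp n 1"
  shows "ext_mult l l = 0"
proof
  fix S
  show "ext_mult l l S = (0 :: 'a ext) S"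
  proof (cases "finite S \<and> card S = 2")
    case True
    then obtain p q where S: "S = {p, q}" "p < q"
      by (metis card_2_iff doubleton_eq_iff linorder_neqE_nat)
    have 1: "{i \<in> {q}. i < p} = {}" "{i \<in> {p}. i < q} = {p}" using S by auto
    have "ext_mult l l S = (\<Sum>j\<in>{p, q}. l {j} * ext_sign {j} ({p, q} - {j}) * l ({p, q} - {j}))"
      using S by (simp add: linear_mult[OF assms])
    also have "\<dots> = l {p} * ext_sign {p} {q} * l {q} + l {q} * ext_sign {q} {p} * l {p}"
    proof -
      have "{p, q} - {p} = {q}" "{p, q} - {q} = {p}" "p \<noteq> q" using S by auto
      then show ?thesis by simp
    qed
    also have "\<dots> = 0" unfolding ext_sign_single 1 by simp
    finally show ?thesis by simp
  next
    case False
    have "l {j} * ext_sign {j} (S - {j}) * l (S - {j}) = 0" if "finite S" "j \<in> S" for j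
    proof -
      have "card (S - {j}) \<noteq> 1" using False that by auto
      then show ?thesis using assms by (auto simp: ext_comp_iff)
    qed
    then show ?thesis
      by (cases "finite S") (auto simp: linear_mult[OF assms] intro!: sum.neutral)
  qed
qed

section \<open>Homogeneous parts\<close>

definition ext_part :: "nat \<Rightarrow> 'k::field ext \<Rightarrow> 'k ext" where
  "ext_part d f = (\<lambda>S. if card S = d then f S else 0)"

lemma ext_part_add: "ext_part d (f + g) = ext_part d f + ext_part d g"
  and ext_part_zero [simp]: "ext_part d 0 = 0"
  and ext_part_scale: "ext_part d (ext_scale c f) = ext_scale c (ext_part d f)"
  by (auto simp: ext_part_def fun_eq_iff)

lemma ext_part_sum: "ext_part d (\<Sum>i\<in>A. F i) = (\<Sum>i\<in>A. ext_part d (F i))"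
  by (rule ext) (simp add: ext_part_def sum_fun_apply)

lemma ext_part_comp: "f \<in> carrier (ext_alg n) \<Longrightarrow> ext_part d f \<in> ext_comp n d"
  by (auto simp: ext_part_def ext_comp_iff carrier_ext_alg split: if_splits)

lemma ext_part_of_comp: "f \<in> ext_comp n k \<Longrightarrow> ext_part d f = (if d = k then f else 0)"
  by (auto simp: ext_part_def ext_comp_iff fun_eq_iff)

lemma ext_part_linear_mult:
  assumes "l \<in> ext_comp n 1"
  shows "ext_part (Suc d) (ext_mult l g) = ext_mult l (ext_part d g)"
    and "ext_part 0 (ext_mult l g) = 0"
proof -
  show "ext_part (Suc d) (ext_mult l g) = ext_mult l (ext_part d g)"
  proof
    fix S
    show "ext_part (Suc d) (ext_mult l g) S = ext_mult l (ext_part d g) S"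
    proof (cases "finite S")
      case True
      then have "card (S - {j}) = d \<longleftrightarrow> card S = Suc d" if "j \<in> S" for j
        using that card_Suc_Diff1[of S j] by auto
      then show ?thesis using True assms by (auto simp: ext_part_def linear_mult intro!: sum.neutral)
    qed (simp add: ext_part_def)
  qed
  show "ext_part 0 (ext_mult l g) = 0"
  proof
    fix S
    show "ext_part 0 (ext_mult l g) S = 0 S"
      using assms by (cases "finite S") (auto simp: ext_part_def linear_mult)
  qed
qed

lemma ext_comp_linear_mult:
  assumes "l \<in> ext_comp n 1" "g \<in> ext_comp n d"
  shows "ext_mult l g \<in> ext_comp n (Suc d)"
proof -
  have "ext_mult l g \<in> carrier (ext_alg n)"
    using assms by (intro ext_mult_closed) (auto intro: ext_comp_carrier)
  moreover have "ext_part (Suc d) (ext_mult l g) = ext_mult l g"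
    using assms by (simp add: ext_part_linear_mult ext_part_of_comp)
  ultimately show ?thesis using ext_part_comp by metis
qed

subsection \<open>Ideals and quotients\<close>

lemma ext_alg_a_inv:
  assumes "f \<in> carrier (ext_alg n)"
  shows "\<ominus>\<^bsub>ext_alg n\<^esub> f = - f"
proof -
  interpret ring "ext_alg n :: 'a ext ring" by (rule ring_ext_alg)
  show ?thesis using assms by (intro minus_equality) (auto simp: carrier_ext_alg_uminus)
qed

lemma ext_mult_const_left:
  "f \<in> carrier (ext_alg n) \<Longrightarrow> ext_mult (ext_const c) f = ext_scale c f"
  using ext_mult_one_left[of f n] by (metis ext_const_eq ext_mult_scale_left ext_vs.scale_one)

lemma ideal_ext_algI:
  assumes sub: "J \<subseteq> carrier (ext_alg n)" and zero: "0 \<in> J"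
    and add: "\<And>f g. f \<in> J \<Longrightarrow> g \<in> J \<Longrightarrow> f + g \<in> J"
    and left: "\<And>f g. f \<in> J \<Longrightarrow> g \<in> carrier (ext_alg n) \<Longrightarrow> ext_mult g f \<in> J"
    and right: "\<And>f g. f \<in> J \<Longrightarrow> g \<in> carrier (ext_alg n) \<Longrightarrow> ext_mult f g \<in> J"
  shows "ideal J (ext_alg n :: 'k::field ext ring)"
proof (rule idealI)
  interpret ring "ext_alg n :: 'k ext ring" by (rule ring_ext_alg)
  show "ring (ext_alg n :: 'k ext ring)" by (rule ring_ext_alg)
  have "- f \<in> J" if "f \<in> J" for f
  proof -
    have "ext_mult (ext_const (- 1)) f \<in> J" using that left by simp
    moreover have "ext_mult (ext_const (- 1)) f = - f"
      using that sub by (subst ext_mult_const_left[of _ n]) (auto simp: fun_eq_iff)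
    ultimately show ?thesis by simp
  qed
  then show "subgroup J (add_monoid (ext_alg n))"
    using sub zero add
    by (intro add.subgroupI) (auto simp flip: a_inv_def simp: ext_alg_a_inv subset_iff)
qed (use left right in auto)

lemma ideal_ext_algD:
  assumes "ideal J (ext_alg n :: 'k::field ext ring)"
  shows "J \<subseteq> carrier (ext_alg n)" "0 \<in> J"
    and "f \<in> J \<Longrightarrow> g \<in> J \<Longrightarrow> f + g \<in> J"
    and "f \<in> J \<Longrightarrow> g \<in> carrier (ext_alg n) \<Longrightarrow> ext_mult g f \<in> J"
    and "f \<in> J \<Longrightarrow> g \<in> carrier (ext_alg n) \<Longrightarrow> ext_mult f g \<in> J"
    and "f \<in> J \<Longrightarrow> ext_scale c f \<in> J"
    and "f \<in> J \<Longrightarrow> g \<in> J \<Longrightarrow> f - g \<in> J"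
proof -
  interpret ideal J "ext_alg n :: 'k ext ring" by fact
  show sub: "J \<subseteq> carrier (ext_alg n)" by (rule a_subset)
  show "0 \<in> J" using additive_subgroup.zero_closed[OF is_additive_subgroup] by simp
  show add: "f + g \<in> J" if "f \<in> J" "g \<in> J" for f g using additive_subgroup.a_closed[OF is_additive_subgroup that] by simp
  show left: "ext_mult g f \<in> J" if "f \<in> J" "g \<in> carrier (ext_alg n)" for f g
    using I_l_closed[OF that] by simp
  show "ext_mult f g \<in> J" if "f \<in> J" "g \<in> carrier (ext_alg n)" for f g
    using I_r_closed[OF that] by simp
  show scale: "ext_scale c f \<in> J" if "f \<in> J" for f c
    using left[OF that, of "ext_const c"] that sub ext_mult_const_left[of f n c] by auto
  show "f - g \<in> J" if "f \<in> J" "g \<in> J" for f g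
  proof -
    have "f + ext_scale (- 1) g = f - g" by (simp add: fun_eq_iff)
    then show ?thesis using add[OF that(1) scale[OF that(2), of "- 1"]] by metis
  qed
qed

lemma ext_class_eq: "ext_class n J f = (\<lambda>h. h + f) ` J"
  by (auto simp: a_r_coset_def')

lemma ext_class_eq_iff:
  assumes "ideal J (ext_alg n)"
  shows "ext_class n J f = ext_class n J g \<longleftrightarrow> f - g \<in> J"
proof
  assume "ext_class n J f = ext_class n J g"
  then have "0 + f \<in> (\<lambda>h. h + g) ` J" using ideal_ext_algD(2)[OF assms] by (metis ext_class_eq imageI)
  then show "f - g \<in> J" by auto
next
  assume fg: "f - g \<in> J"
  have "h + (f - g) \<in> J" "h - (f - g) \<in> J" if "h \<in> J" for h
    using that fg assms by (auto intro: ideal_ext_algD)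
  then show "ext_class n J f = ext_class n J g"
    unfolding ext_class_eq
    by (intro equalityI image_subsetI) (rule image_eqI[rotated], assumption, simp add: algebra_simps)+
qed

lemma ext_quot_simps:
  "carrier (ext_quot n J) = ext_class n J ` carrier (ext_alg n)"
  "\<zero>\<^bsub>ext_quot n J\<^esub> = J"
  "\<one>\<^bsub>ext_quot n J\<^esub> = ext_class n J (ext_const 1)"
  by (auto simp: FactRing_def A_RCOSETS_def')

lemma ext_class_mult:
  assumes "ideal J (ext_alg n)" "f \<in> carrier (ext_alg n)" "g \<in> carrier (ext_alg n)"
  shows "ext_class n J f \<otimes>\<^bsub>ext_quot n J\<^esub> ext_class n J g = ext_class n J (ext_mult f g)"
  using ideal.rcoset_mult_add[OF assms] by (simp add: FactRing_simps)

lemma ext_class_zero: "ext_class n J 0 = J"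
  by (simp add: ext_class_eq)

text \<open>Since \<open>l\<close> squares to 0, its image always lies in its kernel. Only the
  converse has to be supplied, and it is phrased through representatives in the exterior
  algebra.\<close>

lemma regular_formI:
  assumes J: "ideal J (ext_alg n)" and l: "l \<in> ext_comp n 1"
    and ex: "\<And>f. f \<in> carrier (ext_alg n) \<Longrightarrow> ext_mult l f \<in> J \<Longrightarrow>
      \<exists>g\<in>carrier (ext_alg n). f - ext_mult l g \<in> J"
  shows "regular_form n J l"
proof -
  have lc: "l \<in> carrier (ext_alg n)" using l by (rule ext_comp_carrier)
  have kernel: "ext_class n J (ext_mult l f) = J \<longleftrightarrow> ext_mult l f \<in> J" for f
    using ext_class_eq_iff[OF J, of "ext_mult l f" 0] by (simp add: ext_class_zero)
  show ?thesis
    unfolding regular_form_def ext_quot_simps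
  proof (intro equalityI subsetI, goal_cases)
    case (1 m)
    then obtain f where f: "f \<in> carrier (ext_alg n)" "m = ext_class n J f" "ext_mult l f \<in> J"
      using J lc by (auto simp: ext_class_mult kernel)
    then obtain g where g: "g \<in> carrier (ext_alg n)" "f - ext_mult l g \<in> J" using ex by blast
    then have "m = ext_class n J l \<otimes>\<^bsub>ext_quot n J\<^esub> ext_class n J g"
      using J lc f by (simp add: ext_class_mult ext_class_eq_iff)
    then show ?case using g by blast
  next
    case (2 m)
    then obtain g where g: "g \<in> carrier (ext_alg n)"
      and m: "m = ext_class n J l \<otimes>\<^bsub>ext_quot n J\<^esub> ext_class n J g" by blast
    have "ext_mult l (ext_mult l g) = 0"
      using linear_square[OF l] by (metis ext_mult_assoc ext_mult_zero_left)
    then have "ext_mult l (ext_mult l g) \<in> J" using ideal_ext_algD(2)[OF J] by simp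
    then show ?case using J lc g m by (simp add: ext_class_mult kernel ext_mult_closed)
  qed
qed

lemma Idl_ext_alg_insert_linear:
  fixes I :: "'k::field ext set"
  assumes I: "ideal I (ext_alg n)" and l: "l \<in> ext_comp n 1"
  shows "Idl\<^bsub>ext_alg n\<^esub> (I \<union> {l}) = {f + ext_mult l g | f g. f \<in> I \<and> g \<in> carrier (ext_alg n)}"
    (is "_ = ?L")
    and "ideal {f + ext_mult l g | f g. f \<in> I \<and> g \<in> carrier (ext_alg n)} (ext_alg n)"
proof -
  have lc: "l \<in> carrier (ext_alg n)" using l by (rule ext_comp_carrier)
  note D = ideal_ext_algD[OF I]
  show L: "ideal ?L (ext_alg n)"
  proof (rule ideal_ext_algI)
    show "?L \<subseteq> carrier (ext_alg n)"
      using D(1) lc by (auto intro!: carrier_ext_alg_add ext_mult_closed)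
    show "0 \<in> ?L" using D(2) by (auto intro!: exI[of _ 0])
  next
    fix f g :: "'k ext" assume "f \<in> ?L" "g \<in> ?L"
    then obtain a b c d where *: "f = a + ext_mult l b" "g = c + ext_mult l d" "a \<in> I" "c \<in> I"
      "b \<in> carrier (ext_alg n)" "d \<in> carrier (ext_alg n)" by auto
    then have "f + g = (a + c) + ext_mult l (b + d)"
      by (simp add: ext_mult_add_right add_ac)
    then show "f + g \<in> ?L" using * D(3) carrier_ext_alg_add by blast
  next
    fix f g :: "'k ext" assume "f \<in> ?L" and g: "g \<in> carrier (ext_alg n)"
    then obtain a b where *: "f = a + ext_mult l b" "a \<in> I" "b \<in> carrier (ext_alg n)" by auto
    \<comment> \<open>In the product g l b the form \<open>l\<close> moves to the front, at the
      price of the grade involution on \<open>g\<close>.\<close>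
    have "ext_mult g f = ext_mult g a + ext_mult l (ext_mult (ext_inv g) b)"
    proof -
      have "ext_mult g (ext_mult l b) = ext_mult (ext_mult l (ext_inv g)) b"
        by (simp only: mult_linear[OF l] flip: ext_mult_assoc)
      then show ?thesis by (simp only: * ext_mult_add_right ext_mult_assoc)
    qed
    then show "ext_mult g f \<in> ?L" using * g D(4) ext_mult_closed[OF ext_inv_carrier] by blast
    have "ext_mult f g = ext_mult a g + ext_mult l (ext_mult b g)"
      by (simp add: * ext_mult_add_left ext_mult_assoc)
    then show "ext_mult f g \<in> ?L" using * g D(5) ext_mult_closed by blast
  qed
  show "Idl\<^bsub>ext_alg n\<^esub> (I \<union> {l}) = ?L"
  proof
    have "I \<subseteq> ?L"
    proof
      fix f assume "f \<in> I"
      moreover have "f = f + ext_mult l 0" by simp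
      ultimately show "f \<in> ?L" using carrier_ext_alg_zero by blast
    qed
    moreover have "l \<in> ?L"
    proof -
      have "l = 0 + ext_mult l (ext_const 1)" using ext_mult_one_right[OF lc] by simp
      then show ?thesis using D(2) carrier_ext_alg_const by blast
    qed
    ultimately have "?L \<in> {K. ideal K (ext_alg n) \<and> I \<union> {l} \<subseteq> K}" using L by blast
    then show "Idl\<^bsub>ext_alg n\<^esub> (I \<union> {l}) \<subseteq> ?L" unfolding genideal_def by (rule Inter_lower)
    show "?L \<subseteq> Idl\<^bsub>ext_alg n\<^esub> (I \<union> {l})"
    proof clarify
      fix f g :: "'k ext" assume f: "f \<in> I" and g: "g \<in> carrier (ext_alg n)"
      have "f + ext_mult l g \<in> K" if K: "ideal K (ext_alg n)" and IK: "I \<union> {l} \<subseteq> K" for K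
      proof -
        have "ext_mult l g \<in> K" using IK g by (intro ideal_ext_algD(5)[OF K]) auto
        then show ?thesis using IK f by (intro ideal_ext_algD(3)[OF K]) auto
      qed
      then show "f + ext_mult l g \<in> Idl\<^bsub>ext_alg n\<^esub> (I \<union> {l})" by (auto simp: genideal_def)
    qed
  qed
qed

lemma graded_insert_linear:
  assumes I: "graded_ideal n I" and l: "l \<in> ext_comp n 1"
    and f: "f \<in> {f + ext_mult l g | f g. f \<in> I \<and> g \<in> carrier (ext_alg n)}"
  shows "ext_part d f \<in> {f + ext_mult l g | f g. f \<in> I \<and> g \<in> carrier (ext_alg n)}"
proof -
  obtain a b where *: "f = a + ext_mult l b" "a \<in> I" "b \<in> carrier (ext_alg n)" using f by auto
  have a: "ext_part d a \<in> I" using I *(2) by (auto simp: graded_ideal_def ext_part_def)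
  \<comment> \<open>Multiplication by \<open>l\<close> raises degrees by one: degree
    \<open>Suc e\<close> comes from the part of \<open>b\<close> of degree \<open>e\<close>, and
    degree 0 receives nothing.\<close>
  have "ext_part d f = ext_part d a + ext_mult l (case d of 0 \<Rightarrow> 0 | Suc e \<Rightarrow> ext_part e b)"
    by (simp add: * ext_part_add ext_part_linear_mult[OF l] split: nat.split)
  moreover have "(case d of 0 \<Rightarrow> 0 | Suc e \<Rightarrow> ext_part e b) \<in> carrier (ext_alg n)"
    using *(3) by (cases d) (auto intro: ext_comp_carrier[OF ext_part_comp])
  ultimately show ?thesis using a by blast
qed

section \<open>Eliminating variables from a quotient\<close>

lemma carrier_ext_alg_mono: "m \<le> n \<Longrightarrow> carrier (ext_alg m) \<subseteq> carrier (ext_alg n)"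
  by (auto simp: carrier_ext_alg) (meson lessThan_iff less_le_trans subsetD)

lemma ext_comp_mono: "m \<le> n \<Longrightarrow> ext_comp m d \<subseteq> ext_comp n d"
  using carrier_ext_alg_mono[of m n] by (auto simp: ext_comp_def)

lemma ideal_restrict:
  assumes "ideal L (ext_alg n)" "m \<le> n"
  shows "ideal (L \<inter> carrier (ext_alg m)) (ext_alg m)"
proof (rule ideal_ext_algI)
  note D = ideal_ext_algD[OF assms(1)] and sub = carrier_ext_alg_mono[OF assms(2)]
  show "0 \<in> L \<inter> carrier (ext_alg m)" using D(2) by simp
  show "f + g \<in> L \<inter> carrier (ext_alg m)"
    if "f \<in> L \<inter> carrier (ext_alg m)" "g \<in> L \<inter> carrier (ext_alg m)" for f g
    using that D(3) carrier_ext_alg_add by blast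
  show "ext_mult g f \<in> L \<inter> carrier (ext_alg m)"
    if "f \<in> L \<inter> carrier (ext_alg m)" "g \<in> carrier (ext_alg m)" for f g
    using that D(4) sub ext_mult_closed by blast
  show "ext_mult f g \<in> L \<inter> carrier (ext_alg m)"
    if "f \<in> L \<inter> carrier (ext_alg m)" "g \<in> carrier (ext_alg m)" for f g
    using that D(5) sub ext_mult_closed by blast
qed simp

text \<open>The first isomorphism theorem for the inclusion of the smaller algebra followed by the
  projection modulo \<open>L\<close>; its kernel is the contraction of \<open>L\<close>.
  Surjectivity in each degree makes the isomorphism graded.\<close>

lemma graded_alg_iso_restrict:
  assumes L: "ideal L (ext_alg n)" and mn: "m \<le> n"
    and surj: "\<And>f. f \<in> carrier (ext_alg n) \<Longrightarrow> \<exists>g\<in>carrier (ext_alg m). f - g \<in> L"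
    and graded: "\<And>f d. f \<in> ext_comp n d \<Longrightarrow> \<exists>g\<in>ext_comp m d. f - g \<in> L"
  shows "graded_alg_iso m (L \<inter> carrier (ext_alg m)) n (L :: 'k::field ext set)"
proof -
  let ?h = "ext_class n L" and ?J = "L \<inter> carrier (ext_alg m)"
  have sub: "carrier (ext_alg m) \<subseteq> (carrier (ext_alg n) :: 'k ext set)"
    by (rule carrier_ext_alg_mono[OF mn])
  have ker0: "ext_class n L f = L \<longleftrightarrow> f \<in> L" for f
    using ext_class_eq_iff[OF L, of f 0] by (simp add: ext_class_zero)
  then have ker1: "{f \<in> carrier (ext_alg m). ?h f = \<zero>\<^bsub>ext_quot n L\<^esub>} = ?J"
    unfolding ext_quot_simps by blast
  interpret L: ring_hom_ring "ext_alg n" "ext_quot n L" ?h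
    using L by (rule ideal.rcos_ring_hom_ring)
  interpret h: ring_hom_ring "ext_alg m" "ext_quot n L" ?h
  proof (rule ring_hom_ringI)
    show "ring (ext_alg m :: 'k ext ring)" by (rule ring_ext_alg)
    show "ring (ext_quot n L)" by (rule ideal.quotient_is_ring[OF L])
  next
    fix x :: "'k ext" assume "x \<in> carrier (ext_alg m)"
    then have x: "x \<in> carrier (ext_alg n)" using sub by auto
    then show "?h x \<in> carrier (ext_quot n L)" by (rule L.hom_closed)
    fix y :: "'k ext" assume "y \<in> carrier (ext_alg m)"
    then have y: "y \<in> carrier (ext_alg n)" using sub by auto
    show "?h (x \<otimes>\<^bsub>ext_alg m\<^esub> y) = ?h x \<otimes>\<^bsub>ext_quot n L\<^esub> ?h y"
      using L.hom_mult[OF x y] by simp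
    show "?h (x \<oplus>\<^bsub>ext_alg m\<^esub> y) = ?h x \<oplus>\<^bsub>ext_quot n L\<^esub> ?h y"
      using L.hom_add[OF x y] by simp
  next
    show "?h \<one>\<^bsub>ext_alg m\<^esub> = \<one>\<^bsub>ext_quot n L\<^esub>" using L.hom_one by simp
  qed
  have ker: "a_kernel (ext_alg m) (ext_quot n L) ?h = ?J"
    unfolding a_kernel_def' by (rule ker1)
  have img: "?h ` carrier (ext_alg m) = carrier (ext_quot n L)"
  proof (unfold ext_quot_simps, intro equalityI image_subsetI)
    fix f :: "'k ext" assume "f \<in> carrier (ext_alg n)"
    then obtain g where "g \<in> carrier (ext_alg m)" "f - g \<in> L" using surj by blast
    then show "?h f \<in> ?h ` carrier (ext_alg m)" using ext_class_eq_iff[OF L, of f g] by auto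
  qed (use sub in auto)
  define \<phi> where "\<phi> = (\<lambda>X. the_elem (?h ` X))"
  have iso: "\<phi> \<in> ring_iso (ext_quot m ?J) (ext_quot n L)"
    using h.FactRing_iso_set[OF img] by (simp add: ker \<phi>_def)
  have \<phi>: "\<phi> (ext_class m ?J f) = ?h f" if "f \<in> carrier (ext_alg m)" for f
    using h.the_elem_simp[OF that] by (simp add: ker \<phi>_def)
  have "\<phi> ` (ext_class m ?J ` ext_comp m d) = ?h ` ext_comp n d" for d
  proof -
    have "\<phi> ` (ext_class m ?J ` ext_comp m d) = ?h ` ext_comp m d"
      unfolding image_image by (rule image_cong) (auto intro!: \<phi> ext_comp_carrier)
    also have "\<dots> = ?h ` ext_comp n d"
    proof (intro equalityI image_subsetI)
      fix f :: "'k ext" assume "f \<in> ext_comp n d"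
      then obtain g where "g \<in> ext_comp m d" "f - g \<in> L" using graded by blast
      then show "?h f \<in> ?h ` ext_comp m d" using ext_class_eq_iff[OF L, of f g] by auto
    qed (use ext_comp_mono[OF mn] in auto)
    finally show ?thesis .
  qed
  then show ?thesis
    unfolding graded_alg_iso_def using iso \<phi> by (intro bexI[of _ \<phi>]) auto
qed

subsection \<open>Contracting homotopies\<close>

lemma ext_sign_single_Diff: "ext_sign {j} (S - {j}) = (ext_sign {j} S :: 'k::field)"
proof -
  have "{i \<in> S - {j}. i < j} = {i \<in> S. i < j}" by auto
  then show ?thesis by (simp add: ext_sign_single)
qed

lemma ext_sign_single_insert:
  assumes "finite S" "w \<notin> S"
  shows "ext_sign {j} (insert w S) = (if w < j then - 1 else 1) * (ext_sign {j} S :: 'k::field)"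
proof -
  have "{i \<in> insert w S. i < j} = (if w < j then insert w {i \<in> S. i < j} else {i \<in> S. i < j})"
    by auto
  then show ?thesis using assms by (simp add: ext_sign_single)
qed

text \<open>The interior product with the variable \<open>w S\<close>, which may vary with the
  monomial. Infinite sets get the value 0, in agreement with \<open>ext_mult\<close>.\<close>

definition ext_contract :: "(nat set \<Rightarrow> nat) \<Rightarrow> 'k::field ext \<Rightarrow> 'k ext" where
  "ext_contract w f = (\<lambda>S. if w S \<in> S \<or> infinite S then 0
    else ext_sign {w S} S * f (insert (w S) S))"

text \<open>For a constant choice \<open>w\<close> this is the Leibniz rule: contracting l f gives f
  minus \<open>l\<close> times the contraction of f, as \<open>l\<close> has coefficient 1 at the
  chosen variable. A varying choice is harmless because multiplication by \<open>l\<close> relates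
  \<open>S\<close> only to \<open>S - {j}\<close> with \<open>j\<close> in the support of
  \<open>l\<close>, and \<open>inv\<close> keeps the choice constant along such steps.\<close>

lemma ext_contract_homotopy:
  assumes l: "l \<in> ext_comp n 1" and f: "f \<in> carrier (ext_alg n)"
    and w: "\<And>S. l {w S} = 1" and inv: "\<And>S j. l {j} \<noteq> 0 \<Longrightarrow> w (S - {j}) = w S"
  shows "f - ext_mult l (ext_contract w f) = ext_contract w (ext_mult l f)"
proof
  fix S
  show "(f - ext_mult l (ext_contract w f)) S = ext_contract w (ext_mult l f) S"
  proof (cases "finite S")
    case False
    then show ?thesis using f by (auto simp: ext_contract_def carrier_ext_alg intro: finite_subset)
  next
    case fin: True
    show ?thesis
    proof (cases "w S \<in> S")
      case True
      \<comment> \<open>For any other \<open>j\<close> in the support of \<open>l\<close>, the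
        chosen variable still lies in \<open>S - {j}\<close>, where the contraction is 0.\<close>
      have "ext_mult l (ext_contract w f) S = (\<Sum>j\<in>S. if j = w S then f S else 0)"
        unfolding linear_mult[OF l fin]
      proof (rule sum.cong[OF refl])
        fix j assume "j \<in> S"
        show "l {j} * ext_sign {j} (S - {j}) * ext_contract w f (S - {j}) = (if j = w S then f S else 0)"
        proof (cases "l {j} = 0")
          case True
          then show ?thesis using w[of S] by auto
        next
          case False
          then show ?thesis
            using fin inv[OF False, of S] w[of S] \<open>w S \<in> S\<close>
            by (auto simp: ext_contract_def insert_absorb ext_sign_single_Diff)
        qed
      qed
      then show ?thesis using True fin by (simp add: ext_contract_def)
    next
      case False
      have "ext_contract w (ext_mult l f) S = ext_sign {w S} S *
          (\<Sum>j\<in>insert (w S) S. l {j} * ext_sign {j} (insert (w S) S - {j}) * f (insert (w S) S - {j}))"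
        using False fin by (simp add: ext_contract_def linear_mult[OF l])
      also have "\<dots> = f S + (\<Sum>j\<in>S. ext_sign {w S} S *
          (l {j} * ext_sign {j} (insert (w S) S - {j}) * f (insert (w S) S - {j})))"
      proof -
        have "insert (w S) S - {w S} = S" using False by simp
        moreover have "ext_sign {w S} S * (ext_sign {w S} S * f S) = f S"
          by (simp flip: mult.assoc)
        ultimately show ?thesis
          using False fin w[of S] by (simp add: distrib_left sum_distrib_left)
      qed
      also have "(\<Sum>j\<in>S. ext_sign {w S} S *
          (l {j} * ext_sign {j} (insert (w S) S - {j}) * f (insert (w S) S - {j}))) =
        (\<Sum>j\<in>S. - (l {j} * ext_sign {j} (S - {j}) * ext_contract w f (S - {j})))"
      proof (rule sum.cong[OF refl])
        fix j assume j: "j \<in> S"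
        have jw: "j \<noteq> w S" using j False by auto
        \<comment> \<open>Exactly one of \<open>w S < j\<close> and \<open>j < w S\<close> holds, so
          facts 1 and 2 together contribute a single factor -1: the two variables
          anticommute.\<close>
        have 1: "ext_sign {j} (insert (w S) S) = (if w S < j then - 1 else 1) * (ext_sign {j} S :: 'a)"
          using fin False by (rule ext_sign_single_insert)
        have "ext_sign {w S} (insert j (S - {j})) =
          (if j < w S then - 1 else 1) * (ext_sign {w S} (S - {j}) :: 'a)"
          using fin by (intro ext_sign_single_insert) auto
        then have 2: "ext_sign {w S} S = (if j < w S then - 1 else 1) * (ext_sign {w S} (S - {j}) :: 'a)"
          using j by (simp add: insert_absorb)
        have 3: "insert (w S) S - {j} = insert (w S) (S - {j})" using jw by auto
        show "ext_sign {w S} S * (l {j} * ext_sign {j} (insert (w S) S - {j}) * f (insert (w S) S - {j})) =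
          - (l {j} * ext_sign {j} (S - {j}) * ext_contract w f (S - {j}))"
        proof (cases "l {j} = 0")
          case nz: False
          have "ext_contract w f (S - {j}) = ext_sign {w S} (S - {j}) * f (insert (w S) (S - {j}))"
            using fin False inv[OF nz, of S] by (simp add: ext_contract_def)
          moreover have "ext_sign {j} (insert (w S) S - {j}) = (ext_sign {j} (insert (w S) S) :: 'a)"
            by (rule ext_sign_single_Diff)
          ultimately show ?thesis
            unfolding 3 ext_sign_single_Diff
            using jw 1 2 by (cases "w S < j") auto
        qed simp
      qed
      also have "\<dots> = - ext_mult l (ext_contract w f) S"
        by (simp add: linear_mult[OF l fin] sum_negf)
      finally show ?thesis by simp
    qed
  qed
qed

lemma ext_contract_carrier:
  assumes "f \<in> carrier (ext_alg n)"
  shows "ext_contract w f \<in> carrier (ext_alg n)"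
proof (rule carrier_ext_algI)
  fix S assume "ext_contract w f S \<noteq> 0"
  then have "f (insert (w S) S) \<noteq> 0" by (auto simp: ext_contract_def split: if_splits)
  then show "S \<subseteq> {..<n}" using carrier_ext_algD[OF assms] by blast
qed

subsection \<open>The edge ideal of a path\<close>

definition consecutive :: "nat set \<Rightarrow> bool" where
  "consecutive S \<longleftrightarrow> (\<exists>i\<in>S. Suc i \<in> S)"

lemma consecutive_mono: "consecutive S \<Longrightarrow> S \<subseteq> T \<Longrightarrow> consecutive T"
  by (auto simp: consecutive_def)

text \<open>The edge ideal, given by its basis of monomials instead of by generators; membership
  becomes a condition on single coefficients.\<close>

definition path_ideal :: "nat \<Rightarrow> 'k::field ext set" where
  "path_ideal n = {f \<in> carrier (ext_alg n). \<forall>S. f S \<noteq> 0 \<longrightarrow> consecutive S}"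

lemma path_idealD: "f \<in> path_ideal n \<Longrightarrow> \<not> consecutive S \<Longrightarrow> f S = 0"
  by (auto simp: path_ideal_def)

lemma ideal_path_ideal: "ideal (path_ideal n :: 'k::field ext set) (ext_alg n)"
proof (rule ideal_ext_algI)
  show "path_ideal n \<subseteq> (carrier (ext_alg n) :: 'k ext set)" "0 \<in> (path_ideal n :: 'k ext set)"
    by (auto simp: path_ideal_def)
  fix f g :: "'k ext" assume f: "f \<in> path_ideal n"
  {
    assume g: "g \<in> path_ideal n"
    have "(f + g) S = 0" if "\<not> consecutive S" for S
      using path_idealD[OF f that] path_idealD[OF g that] by simp
    then show "f + g \<in> path_ideal n"
      using f g carrier_ext_alg_add by (auto simp: path_ideal_def)
  }
  assume g: "g \<in> carrier (ext_alg n)"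
  have "ext_mult f g S = 0 \<and> ext_mult g f S = 0" if "\<not> consecutive S" for S
  proof -
    have "f T = 0 \<and> f (S - T) = 0" if "T \<subseteq> S" for T
      using \<open>\<not> consecutive S\<close> that path_idealD[OF f] consecutive_mono by (metis Diff_subset)
    then show ?thesis by (auto simp: ext_mult_def intro!: sum.neutral)
  qed
  then show "ext_mult g f \<in> path_ideal n" "ext_mult f g \<in> path_ideal n"
    using f g ext_mult_closed[of f n g] ext_mult_closed[of g n f] by (auto simp: path_ideal_def)
qed

lemma graded_path_ideal: "graded_ideal n (path_ideal n)"
  unfolding graded_ideal_def using ideal_path_ideal
  by (auto simp: path_ideal_def carrier_ext_alg split: if_splits)

section \<open>Standard coordinates and a Groebner basis of the path ideal\<close>

lemma foldr_ext_mono: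
  "sorted xs \<Longrightarrow> distinct xs \<Longrightarrow>
    foldr (\<lambda>i f. ext_mult (ext_mono {i}) f) xs (ext_const 1) = (ext_mono (set xs) :: 'k::field ext)"
proof (induction xs)
  case Nil
  then show ?case by (simp add: ext_const_eq)
next
  case (Cons i xs)
  then have e: "{k \<in> set xs. k < i} = {}" by auto
  have "ext_sign {i} (set xs) = (1 :: 'k)" unfolding ext_sign_single e by simp
  then show ?case using Cons by (auto simp: ext_mono_mult)
qed

lemma coord_monomial_mono:
  "finite S \<Longrightarrow> coord_monomial n (\<lambda>i. ext_mono {i}) S = (ext_mono S :: 'k::field ext)"
  unfolding coord_monomial_def by (simp add: foldr_ext_mono)

lemma coordinates_mono: "coordinates n (\<lambda>i. ext_mono {i} :: 'k::field ext)"
  unfolding coordinates_def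
proof (intro conjI ballI allI impI)
  show "ext_mono {i} \<in> ext_comp n 1" if "i < n" for i
    using that ext_mono_comp[of "{i}" n] by simp
next
  fix f :: "'k ext" assume f: "f \<in> ext_comp n 1"
  have coef: "(\<Sum>i<n. c i * ext_mono {i} {j}) = c j" if "j < n" for c :: "nat \<Rightarrow> 'k" and j
    using that by (simp add: ext_mono_def if_distrib cong: if_cong)
  show "\<exists>!c. (\<forall>i\<ge>n. c i = 0) \<and> f = (\<lambda>S. \<Sum>i<n. c i * ext_mono {i} S)"
  proof (rule ex1I[of _ "\<lambda>i. f {i}"])
    have 1: "f S = (\<Sum>i<n. f {i} * ext_mono {i} S)" for S
    proof (cases "\<exists>j<n. S = {j}")
      case False
      then have "f S = 0" using f by (auto simp: ext_comp_iff card_1_singleton_iff)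
      moreover have "(\<Sum>i<n. f {i} * ext_mono {i} S) = 0"
        using False by (intro sum.neutral) (auto simp: ext_mono_def)
      ultimately show ?thesis by simp
    qed (auto simp: coef)
    have 2: "\<forall>i\<ge>n. f {i} = 0" using f by (auto simp: ext_comp_iff)
    show "(\<forall>i\<ge>n. f {i} = 0) \<and> f = (\<lambda>S. \<Sum>i<n. f {i} * ext_mono {i} S)"
      by (rule conjI[OF 2 ext[OF 1]])
  next
    fix c :: "nat \<Rightarrow> 'k"
    assume c: "(\<forall>i\<ge>n. c i = 0) \<and> f = (\<lambda>S. \<Sum>i<n. c i * ext_mono {i} S)"
    show "c = (\<lambda>i. f {i})"
    proof
      fix i
      show "c i = f {i}"
      proof (cases "i < n")
        case True
        have "f {i} = (\<Sum>k<n. c k * ext_mono {k} {i})" using c by metis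
        then show ?thesis using coef[OF True, of c] by simp
      next
        case False
        then show ?thesis using c f by (auto simp: ext_comp_iff)
      qed
    qed
  qed
qed

text \<open>Sets are compared as binary numbers. The encoding is injective on finite sets and turns
  disjoint unions into sums, which makes the order compatible with products.\<close>

lemma monomial_order_set_encode:
  "monomial_order n {(S, T). S \<subseteq> {..<n} \<and> T \<subseteq> {..<n} \<and> set_encode S \<le> set_encode T}"
proof -
  have inj: "S = T" if "set_encode S = set_encode T" "S \<subseteq> {..<n}" "T \<subseteq> {..<n}" for S T
    using that inj_on_set_encode by (auto dest!: inj_onD intro: finite_subset)
  have add: "set_encode (S \<union> U) = set_encode S + set_encode U"
    if "S \<subseteq> {..<n}" "U \<subseteq> {..<n}" "S \<inter> U = {}" for S U
    unfolding set_encode_def using that by (intro sum.union_disjoint) (auto intro: finite_subset)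
  have "linear_order_on (Pow {..<n}) {(S, T). S \<subseteq> {..<n} \<and> T \<subseteq> {..<n} \<and> set_encode S \<le> set_encode T}"
    using inj by (auto simp: linear_order_on_def partial_order_on_def preorder_on_def refl_on_def
        trans_on_def antisym_def total_on_def)
  then show ?thesis
    unfolding monomial_order_def by (auto simp: add)
qed

text \<open>In standard coordinates the expansion coefficients are the values of \<open>f\<close>
  itself. That the leading one is nonzero is all a monomial ideal has to know about it.\<close>

lemma leading_term_mono:
  assumes "leading_term n (\<lambda>i. ext_mono {i}) r f t"
  obtains M where "M \<subseteq> {..<n}" "f M \<noteq> 0" "t = ext_scale (f M) (ext_mono M)"
proof -
  obtain c M where f: "f = (\<lambda>U. \<Sum>S\<in>Pow {..<n}. c S * coord_monomial n (\<lambda>i. ext_mono {i}) S U)"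
    and M: "M \<subseteq> {..<n}" "c M \<noteq> 0" "t = (\<lambda>U. c M * coord_monomial n (\<lambda>i. ext_mono {i}) M U)"
    using assms unfolding leading_term_def by blast
  have fin: "finite S" if "S \<subseteq> {..<n}" for S using that by (rule finite_subset) simp
  have "coord_monomial n (\<lambda>i. ext_mono {i}) S M = (if S = M then 1 else 0 :: 'a)"
    if "S \<subseteq> {..<n}" for S
    unfolding coord_monomial_mono[OF fin[OF that]] by (auto simp: ext_mono_def)
  then have "f M = (\<Sum>S\<in>Pow {..<n}. if S = M then c M else 0)"
    unfolding f by (intro sum.cong) auto
  then have "f M = c M" using M by simp
  then show ?thesis using that M fin by (simp add: coord_monomial_mono ext_scale_def)
qed

lemma G_quadratic_path_ideal: "G_quadratic n (path_ideal n :: 'k::field ext set)"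
proof -
  let ?b = "\<lambda>i. ext_mono {i} :: 'k ext"
  let ?r = "{(S, T). S \<subseteq> {..<n} \<and> T \<subseteq> {..<n} \<and> set_encode S \<le> set_encode T}"
  let ?J = "path_ideal n :: 'k ext set"
  define G where "G = (\<lambda>i. ext_mono {i, Suc i} :: 'k ext) ` {i. Suc i < n}"
  have sub: "{i, Suc i} \<subseteq> {..<n}" if "Suc i < n" for i using that by auto
  have comp: "ext_mono {i, Suc i} \<in> (ext_comp n 2 :: 'k ext set)" if "Suc i < n" for i
    using ext_mono_comp[OF sub[OF that]] by (simp add: numeral_2_eq_2)
  have G2: "G \<subseteq> ext_comp n 2" using comp by (auto simp: G_def)
  have GJ: "G \<subseteq> ?J"
    using comp by (auto simp: G_def path_ideal_def ext_mono_def consecutive_def ext_comp_def split: if_splits)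
  have lt: "leading_term n ?b ?r (ext_mono {i, Suc i}) (ext_mono {i, Suc i})" if "Suc i < n" for i
    unfolding leading_term_def
  proof (intro exI[of _ "\<lambda>S. if S = {i, Suc i} then 1 else 0"] exI[of _ "{i, Suc i}"] conjI)
    show "ext_mono {i, Suc i} = (\<lambda>U. \<Sum>S\<in>Pow {..<n}.
        (if S = {i, Suc i} then 1 else 0) * coord_monomial n ?b S U)"
      using sub[OF that] by (simp add: if_distrib[of "\<lambda>x. x * _"] coord_monomial_mono cong: if_cong)
  qed (use sub[OF that] in \<open>auto simp: coord_monomial_mono\<close>)
  have "lt_ideal n ?b ?r ?J \<subseteq> lt_ideal n ?b ?r G"
    unfolding lt_ideal_def genideal_def
  proof (intro Inter_anti_mono subsetI, clarify)
    fix K t f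
    assume K: "ideal K (ext_alg n)" and GK: "{t. \<exists>f\<in>G. leading_term n ?b ?r f t} \<subseteq> K"
      and f: "f \<in> ?J" and t: "leading_term n ?b ?r f t"
    obtain M where M: "M \<subseteq> {..<n}" "f M \<noteq> 0" "t = ext_scale (f M) (ext_mono M)"
      using leading_term_mono[OF t] by blast
    \<comment> \<open>Every monomial occurring in \<open>f\<close> contains an edge, in particular
      the leading one; it is then a multiple of the generator of that edge.\<close>
    obtain i where i: "i \<in> M" "Suc i \<in> M"
      using f M(2) by (auto simp: path_ideal_def consecutive_def)
    let ?N = "M - {i, Suc i}"
    have fin: "finite M" using M(1) by (rule finite_subset) simp
    have "Suc i < n" using i M by auto
    then have "ext_mono {i, Suc i} \<in> K" using GK lt by (auto simp: G_def)
    moreover have "ext_mono ?N \<in> carrier (ext_alg n)"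
      using M(1) by (intro ext_comp_carrier[OF ext_mono_comp]) auto
    ultimately have "ext_mult (ext_mono {i, Suc i}) (ext_mono ?N) \<in> K"
      by (rule ideal_ext_algD(5)[OF K])
    moreover have "ext_mult (ext_mono {i, Suc i}) (ext_mono ?N) =
        ext_scale (ext_sign {i, Suc i} ?N) (ext_mono M :: 'k ext)"
    proof -
      have "{i, Suc i} \<union> ?N = M" using i by auto
      then show ?thesis using fin by (subst ext_mono_mult) auto
    qed
    ultimately have "ext_scale (f M / ext_sign {i, Suc i} ?N)
        (ext_scale (ext_sign {i, Suc i} ?N) (ext_mono M)) \<in> K"
      using ideal_ext_algD(6)[OF K] by metis
    then show "t \<in> K" using M by simp
  qed
  moreover have "lt_ideal n ?b ?r G \<subseteq> lt_ideal n ?b ?r ?J"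
    unfolding lt_ideal_def genideal_def using GJ by (intro Inter_anti_mono) blast
  moreover have "finite {i. Suc i < n}" by (rule finite_subset[of _ "{..<n}"]) auto
  ultimately have "groebner_basis n ?b ?r ?J G"
    using GJ unfolding groebner_basis_def by (auto simp: G_def)
  then show ?thesis
    unfolding G_quadratic_def
    using graded_path_ideal coordinates_mono monomial_order_set_encode G2 by blast
qed

section \<open>The regular linear form and the sliced ideal\<close>

definition path_form :: "'k::field ext" where
  "path_form = ext_mono {0} + ext_mono {3} + ext_mono {6}"

lemma path_form_comp: "path_form \<in> (ext_comp 7 1 :: 'k::field ext set)"
  by (auto simp: path_form_def ext_comp_iff ext_mono_def split: if_splits)

lemma path_form_apply: "path_form {j} = (if j = 0 \<or> j = 3 \<or> j = 6 then 1 else 0 :: 'k::field)"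
  by (auto simp: path_form_def ext_mono_def)

(* The vertices 0, 3, 6 of the path are independent, and every independent set of other vertices
   leaves one of them without neighbours. *)
definition path_vertex :: "nat set \<Rightarrow> nat" where
  "path_vertex S = (if 1 \<notin> S then 0 else if 5 \<notin> S then 6 else 3)"

lemma regular_path_form: "regular_form 7 (path_ideal 7) (path_form :: 'k::field ext)"
proof (rule regular_formI[OF ideal_path_ideal path_form_comp])
  fix f :: "'k ext"
  assume f: "f \<in> carrier (ext_alg 7)" and lf: "ext_mult path_form f \<in> path_ideal 7"
  \<comment> \<open>\<open>path_vertex\<close> inspects only 1 and 5, which lie outside the support
    {0, 3, 6} of the form, so deleting a vertex of the support does not change the choice.\<close>
  have hom: "f - ext_mult path_form (ext_contract path_vertex f) =
      ext_contract path_vertex (ext_mult path_form f)"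
    by (rule ext_contract_homotopy[OF path_form_comp f])
      (auto simp: path_form_apply path_vertex_def split: if_splits)
  \<comment> \<open>Adding the chosen vertex to an independent set creates no edge. Hence a nonzero
    coefficient of the contraction at an independent \<open>S\<close> would come from an independent
    set, where the product with the form vanishes.\<close>
  have "consecutive S" if "ext_contract path_vertex (ext_mult path_form f) S \<noteq> 0" for S
  proof (rule ccontr)
    assume S: "\<not> consecutive S"
    let ?w = "path_vertex S"
    have w: "?w \<notin> S" and "ext_mult path_form f (insert ?w S) \<noteq> 0"
      using that by (auto simp: ext_contract_def split: if_splits)
    then have "consecutive (insert ?w S)" "insert ?w S \<subseteq> {..<7}"
      using lf by (auto simp: path_ideal_def carrier_ext_alg)
    then obtain i where i: "i \<in> insert ?w S" "Suc i \<in> insert ?w S" "Suc i < 7"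
      unfolding consecutive_def by blast
    then have ii: "i = ?w \<and> Suc i \<in> S \<or> i \<in> S \<and> Suc i = ?w"
      using S by (auto simp: consecutive_def)
    \<comment> \<open>The vertex 3 is chosen only if 1 and 5 lie in \<open>S\<close>; independence
      then excludes its neighbours 2 and 4.\<close>
    have "\<not> (Suc 1 \<in> S \<and> 1 \<in> S)" "\<not> (Suc 4 \<in> S \<and> 4 \<in> S)"
      using S by (auto simp: consecutive_def)
    then show False
      using ii i(3) by (auto simp: path_vertex_def numeral_2_eq_2 split: if_splits)
  qed
  moreover have "ext_contract path_vertex (ext_mult path_form f) \<in> carrier (ext_alg 7)"
    using f by (intro ext_contract_carrier ext_mult_closed ext_comp_carrier[OF path_form_comp])
  ultimately have "f - ext_mult path_form (ext_contract path_vertex f) \<in> path_ideal 7"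
    unfolding hom path_ideal_def by blast
  then show "\<exists>g\<in>carrier (ext_alg 7). f - ext_mult path_form g \<in> path_ideal 7"
    using ext_contract_carrier[OF f] by blast
qed

definition path_section :: "'k::field ext set" where
  "path_section = {f + ext_mult path_form g | f g. f \<in> path_ideal 7 \<and> g \<in> carrier (ext_alg 7)}"

lemma ideal_path_section: "ideal path_section (ext_alg 7)"
  and Idl_path_section: "Idl\<^bsub>ext_alg 7\<^esub> (path_ideal 7 \<union> {path_form}) = path_section"
  unfolding path_section_def
  by (rule Idl_ext_alg_insert_linear[OF ideal_path_ideal path_form_comp])+

(* The quotient of the path algebra by the regular form, with e_6 eliminated. *)
definition sliced_ideal :: "'k::field ext set" where
  "sliced_ideal = path_section \<inter> carrier (ext_alg 6)"

lemma ideal_sliced_ideal: "ideal sliced_ideal (ext_alg 6)"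
  unfolding sliced_ideal_def by (rule ideal_restrict[OF ideal_path_section]) simp

lemma graded_sliced_ideal: "graded_ideal 6 (sliced_ideal :: 'k::field ext set)"
proof -
  have "ext_part d f \<in> sliced_ideal" if f: "f \<in> sliced_ideal" for f :: "'k ext" and d
  proof -
    have "ext_part d f \<in> path_section"
      using f graded_insert_linear[OF graded_path_ideal path_form_comp, of f d]
      by (simp add: sliced_ideal_def path_section_def)
    moreover have "ext_part d f \<in> carrier (ext_alg 6)"
      using f by (intro ext_comp_carrier[OF ext_part_comp]) (simp add: sliced_ideal_def)
    ultimately show ?thesis by (simp add: sliced_ideal_def)
  qed
  then show ?thesis
    unfolding graded_ideal_def using ideal_sliced_ideal by (simp add: ext_part_def)
qed

lemma LG_quadratic_sliced_ideal: "LG_quadratic 6 (sliced_ideal :: 'k::field ext set)"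
proof -
  \<comment> \<open>By the homotopy formula with constant choice 6, \<open>?h f\<close> differs from
    \<open>f\<close> by a multiple of the form, and a contraction by e_6 does not involve e_6. So
    \<open>?h\<close> is the substitution of -(e_0 + e_3) for e_6.\<close>
  let ?h = "\<lambda>f. ext_contract (\<lambda>_. 6) (ext_mult path_form f) :: 'k ext"
  have diff: "f - ?h f \<in> path_section" if f: "f \<in> carrier (ext_alg 7)" for f
  proof -
    have "f - ext_mult path_form (ext_contract (\<lambda>_. 6) f) = ?h f"
      by (rule ext_contract_homotopy[OF path_form_comp f]) (auto simp: path_form_apply)
    then have "f - ?h f = 0 + ext_mult path_form (ext_contract (\<lambda>_. 6) f)"
      by (simp add: algebra_simps)
    then show ?thesis
      unfolding path_section_def
      using ext_contract_carrier[OF f] ideal_ext_algD(2)[OF ideal_path_ideal] by blast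
  qed
  have comp: "?h f \<in> ext_comp 6 d" if f: "f \<in> ext_comp 7 d" for f d
  proof -
    have "ext_mult path_form f \<in> ext_comp 7 (Suc d)"
      by (rule ext_comp_linear_mult[OF path_form_comp f])
    then show ?thesis
      by (force simp: ext_comp_iff ext_contract_def less_Suc_eq numeral_eq_Suc split: if_splits)
  qed
  have carr: "?h f \<in> carrier (ext_alg 6)" if f: "f \<in> carrier (ext_alg 7)" for f
  proof (rule carrier_ext_algI)
    have "ext_mult path_form f \<in> carrier (ext_alg 7)"
      using f by (intro ext_mult_closed ext_comp_carrier[OF path_form_comp])
    then show "S \<subseteq> {..<6}" if "?h f S \<noteq> 0" for S
      using that
      by (force simp: carrier_ext_alg ext_contract_def less_Suc_eq numeral_eq_Suc split: if_splits)
  qed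
  have "graded_alg_iso 6 (sliced_ideal :: 'k ext set) 7 path_section"
    unfolding sliced_ideal_def
  proof (rule graded_alg_iso_restrict[OF ideal_path_section])
    show "\<exists>g\<in>carrier (ext_alg 6). f - g \<in> path_section"
      if "f \<in> carrier (ext_alg 7)" for f :: "'k ext"
      using diff[OF that] carr[OF that] by blast
    show "\<exists>g\<in>ext_comp 6 d. f - g \<in> path_section" if "f \<in> ext_comp 7 d" for f :: "'k ext" and d
      using diff[OF ext_comp_carrier[OF that]] comp[OF that] by blast
  qed simp
  moreover have "regular_sequence 7 (path_ideal 7) [path_form :: 'k ext]"
  proof -
    have "Idl\<^bsub>ext_alg 7\<^esub> (path_ideal 7) = (path_ideal 7 :: 'k ext set)"
      unfolding genideal_def using ideal_path_ideal by blast
    then show ?thesis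
      by (simp add: regular_sequence_def path_form_comp[unfolded One_nat_def] regular_path_form)
  qed
  ultimately show ?thesis
    unfolding LG_quadratic_def
    using graded_sliced_ideal G_quadratic_path_ideal
    by (intro conjI exI[of _ 7] exI[of _ "path_ideal 7"] exI[of _ "[path_form]"])
      (simp_all add: Idl_path_section[simplified])
qed

subsection \<open>The graded pieces of the ideal\<close>

lemma linear_mult_doubleton:
  assumes "l \<in> ext_comp n 1" "p < q"
  shows "ext_mult l g {p, q} = l {p} * g {q} - l {q} * g {p}"
proof -
  have e: "{i \<in> {q}. i < p} = {}" "{i \<in> {p}. i < q} = {p}" using assms(2) by auto
  have d: "{p, q} - {p} = {q}" "{p, q} - {q} = {p}" "p \<noteq> q" using assms(2) by auto
  have "ext_mult l g {p, q} = l {p} * ext_sign {p} {q} * g {q} + l {q} * ext_sign {q} {p} * g {p}"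
    using d by (simp add: linear_mult[OF assms(1)])
  then show ?thesis unfolding ext_sign_single e by simp
qed

lemma linear_mult_tripleton:
  assumes "l \<in> ext_comp n 1" "p < q" "q < r"
  shows "ext_mult l g {p, q, r} = l {p} * g {q, r} - l {q} * g {p, r} + l {r} * g {p, q}"
proof -
  have e: "{i \<in> {q, r}. i < p} = {}" "{i \<in> {p, r}. i < q} = {p}" "{i \<in> {p, q}. i < r} = {p, q}"
    using assms by auto
  have d: "{p, q, r} - {p} = {q, r}" "{p, q, r} - {q} = {p, r}" "{p, q, r} - {r} = {p, q}"
    "p \<noteq> q" "p \<noteq> r" "q \<noteq> r"
    using assms by auto
  have "ext_mult l g {p, q, r} = l {p} * ext_sign {p} {q, r} * g {q, r} +
      l {q} * ext_sign {q} {p, r} * g {p, r} + l {r} * ext_sign {r} {p, q} * g {p, q}"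
    using d by (simp add: linear_mult[OF assms(1)])
  then show ?thesis unfolding ext_sign_single e using d by simp
qed

lemma sliced_idealE:
  assumes "f \<in> sliced_ideal"
  obtains a g where "f = a + ext_mult path_form g" "a \<in> path_ideal 7" "g \<in> carrier (ext_alg 7)"
    "f \<in> carrier (ext_alg 6)"
  using assms by (auto simp: sliced_ideal_def path_section_def)

text \<open>Rules out the trivial obstruction: a nonzero linear element has a linear leading term,
  which no set of quadrics can generate.\<close>

lemma sliced_ideal_linear: "sliced_ideal \<inter> ext_comp 6 1 \<subseteq> {0 :: 'k::field ext}"
proof
  fix f :: "'k ext" assume "f \<in> sliced_ideal \<inter> ext_comp 6 1"
  then have "f \<in> sliced_ideal" and f1: "f \<in> ext_comp 6 1" by auto
  then obtain a g where f: "f = a + ext_mult path_form g" and a: "a \<in> path_ideal 7"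
    and f6: "f \<in> carrier (ext_alg 6)" by (elim sliced_idealE)
  have val: "f {p} = path_form {p} * g {}" for p
    using path_idealD[OF a, of "{p}"]
    by (simp add: f linear_mult[OF path_form_comp] consecutive_def)
  \<comment> \<open>The absence of e_6 from \<open>f\<close> is turned into a condition on
    \<open>g\<close>, since the form has coefficient 1 at e_6. The same device serves in degrees 2
    and 3.\<close>
  have "f {6} = 0" using f6 by (auto simp: carrier_ext_alg)
  then have "g {} = 0" using val[of 6] by (simp add: path_form_apply)
  then have "f {p} = 0" for p using val by simp
  then have "f S = 0" for S
    using f1 by (cases "card S = 1") (auto simp: ext_comp_iff card_1_singleton_iff)
  then show "f \<in> {0}" by auto
qed

lemma sorted_doubleton:
  assumes "card S = 2"
  obtains p q :: nat where "p < q" "S = {p, q}"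
  using assms by (metis card_2_iff insert_commute linorder_neqE_nat)

lemma sorted_tripleton:
  assumes "card S = 3"
  obtains p q r :: nat where "p < q" "q < r" "S = {p, q, r}"
proof -
  have fin: "finite S" using assms by (auto intro: card_ge_0_finite)
  define xs where "xs = sorted_list_of_set S"
  have "length xs = 3" using assms fin by (simp add: xs_def)
  then obtain p q r where xs: "xs = [p, q, r]" by (auto simp: numeral_3_eq_3 length_Suc_conv)
  have "set xs = S" "sorted xs" "distinct xs" using fin by (simp_all add: xs_def)
  then show ?thesis using that[of p q r] xs by auto
qed

text \<open>The five edges avoiding the vertex 6, and the image of the edge {5, 6} under the
  substitution of -(e_0 + e_3) for e_6.\<close>

definition sliced_quadrics :: "'k::field ext set" where
  "sliced_quadrics = {ext_mono {0, 1}, ext_mono {1, 2}, ext_mono {2, 3}, ext_mono {3, 4},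
    ext_mono {4, 5}, ext_mono {0, 5} + ext_mono {3, 5}}"

lemma sliced_ideal_quadratic:
  "sliced_ideal \<inter> ext_comp 6 2 \<subseteq> ext_vs.span (sliced_quadrics :: 'k::field ext set)"
proof
  fix f :: "'k ext" assume "f \<in> sliced_ideal \<inter> ext_comp 6 2"
  then have "f \<in> sliced_ideal" and f2: "f \<in> ext_comp 6 2" by auto
  then obtain a g where f: "f = a + ext_mult path_form g" and a: "a \<in> path_ideal 7"
    and f6: "f \<in> carrier (ext_alg 6)" by (elim sliced_idealE)
  have val: "f {p, q} = path_form {p} * g {q} - path_form {q} * g {p}"
    if "p < q" "q \<noteq> Suc p" for p q
  proof -
    have "\<not> consecutive {p, q}" using that by (auto simp: consecutive_def)
    then show ?thesis
      using path_idealD[OF a] that by (simp add: f linear_mult_doubleton[OF path_form_comp])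
  qed
  have "f {p, 6} = 0" for p using f6 by (auto simp: carrier_ext_alg)
  \<comment> \<open>The bound leaves out p = 5, as {5, 6} is an edge. So \<open>g {5}\<close> stays
    free; it is the common coefficient of \<open>f\<close> at {0, 5} and {3, 5}, which accounts for
    the sixth quadric.\<close>
  then have g: "g {p} = path_form {p} * g {6}" if "p < 5" for p
    using val[of p 6] that path_form_apply[of 6, where ?'k = 'k] by simp
  have f0: "f {0, 2} = 0" "f {0, 3} = 0" "f {0, 4} = 0" "f {1, 3} = 0" "f {1, 4} = 0"
      "f {2, 4} = 0" "f {1, 5} = 0" "f {2, 5} = 0" "f {3, 5} = f {0, 5}"
    by (simp_all add: val path_form_apply g)
  have "f = ext_scale (f {0, 1}) (ext_mono {0, 1}) + ext_scale (f {1, 2}) (ext_mono {1, 2})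
      + ext_scale (f {2, 3}) (ext_mono {2, 3}) + ext_scale (f {3, 4}) (ext_mono {3, 4})
      + ext_scale (f {4, 5}) (ext_mono {4, 5})
      + ext_scale (f {0, 5}) (ext_mono {0, 5} + ext_mono {3, 5})" (is "f = ?g")
  proof
    fix S
    show "f S = ?g S"
    proof (cases "S \<subseteq> {..<6} \<and> card S = 2")
      case False
      then have "f S = 0" using f2 by (auto simp: ext_comp_iff)
      moreover have "S \<noteq> {i, j}" if "i < 6" "j < 6" "i \<noteq> j" for i j :: nat
        using False that by auto
      ultimately show ?thesis by (simp add: ext_mono_def)
    next
      case True
      then obtain p q where pq: "p < q" "S = {p, q}" using sorted_doubleton by blast
      have q: "q < 6" using True pq by auto
      have "q = 1 \<or> q = 2 \<or> q = 3 \<or> q = 4 \<or> q = 5" using pq(1) q by arith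
      moreover have "p = 0 \<or> p = 1 \<or> p = 2 \<or> p = 3 \<or> p = 4" using pq(1) q by arith
      ultimately show ?thesis
        using pq f0 by (elim disjE) (simp_all add: ext_mono_def doubleton_eq_iff)
    qed
  qed
  also have "\<dots> \<in> ext_vs.span sliced_quadrics"
    by (intro ext_vs.span_add ext_vs.span_scale ext_vs.span_base) (auto simp: sliced_quadrics_def)
  finally show "f \<in> ext_vs.span sliced_quadrics" .
qed

text \<open>The cubic piece is a hyperplane. Both {0, 2, 4} and {2, 4, 6} are independent, and the
  product of the form with \<open>g\<close> has the same coefficient \<open>g {2, 4}\<close> at
  both; the second must vanish because e_6 does not occur in \<open>f\<close>.\<close>

lemma sliced_ideal_cubic:
  assumes f3: "f \<in> ext_comp 6 3"
  shows "f \<in> sliced_ideal \<longleftrightarrow> f {0, 2, 4} = (0 :: 'k::field)"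
proof
  assume "f \<in> sliced_ideal"
  then obtain a g where f: "f = a + ext_mult path_form g" and a: "a \<in> path_ideal 7"
    and f6: "f \<in> carrier (ext_alg 6)" by (elim sliced_idealE)
  have "f {2, 4, 6} = 0" using f6 by (auto simp: carrier_ext_alg)
  moreover have "\<not> consecutive {0, 2, 4}" "\<not> consecutive {2, 4, 6}"
    by (auto simp: consecutive_def)
  ultimately show "f {0, 2, 4} = 0"
    using path_idealD[OF a]
    by (simp add: f linear_mult_tripleton[OF path_form_comp] path_form_apply)
next
  assume f0: "f {0, 2, 4} = 0"
  \<comment> \<open>Besides {0, 2, 4}, the independent triples without 6 are {0, 2, 5}, {0, 3, 5},
    {1, 3, 5}, and \<open>g\<close> is chosen to reproduce \<open>f\<close> on them. All its pairs
    contain 5, so its product with the form vanishes on {0, 2, 4} and on the independent triples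
    through 6, which avoid 5.\<close>
  define g where "g = ext_scale (f {0, 2, 5}) (ext_mono {2, 5}) +
    ext_scale (f {0, 3, 5}) (ext_mono {3, 5}) + ext_scale (- f {1, 3, 5}) (ext_mono {1, 5})"
  have g2: "g \<in> ext_comp 7 2" by (auto simp: g_def ext_comp_iff ext_mono_def split: if_splits)
  have f7: "f \<in> ext_comp 7 3" using f3 ext_comp_mono[of 6 7 3] by auto
  have lg: "ext_mult path_form g \<in> ext_comp 7 3"
    using ext_comp_linear_mult[OF path_form_comp g2] by (simp add: numeral_3_eq_3 numeral_2_eq_2)
  have "f S = ext_mult path_form g S" if S: "\<not> consecutive S" for S
  proof (cases "S \<subseteq> {..<7} \<and> card S = 3")
    case False
    then have "f S = 0" "ext_mult path_form g S = 0"
      using f7 lg by (auto simp: ext_comp_iff)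
    then show ?thesis by simp
  next
    case True
    then obtain p q r where pqr: "p < q" "q < r" "S = {p, q, r}" using sorted_tripleton by blast
    have r: "r < 7" using True pqr by auto
    have nc: "q \<noteq> Suc p" "r \<noteq> Suc q" using S pqr by (auto simp: consecutive_def)
    have f6: "f {p, q, 6} = 0" using f3 by (auto simp: ext_comp_iff)
    have "r = 4 \<or> r = 5 \<or> r = 6" "q = 2 \<or> q = 3 \<or> q = 4" "p = 0 \<or> p = 1 \<or> p = 2"
      using pqr r nc by arith+
    then show ?thesis
      using pqr nc f0 f6
      by (elim disjE) (simp_all add: linear_mult_tripleton[OF path_form_comp] path_form_apply
        g_def ext_mono_def doubleton_eq_iff)
  qed
  then have "f - ext_mult path_form g \<in> path_ideal 7"
    using carrier_ext_alg_diff[OF ext_comp_carrier[OF f7] ext_comp_carrier[OF lg]]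
    by (auto simp: path_ideal_def)
  moreover have "f = (f - ext_mult path_form g) + ext_mult path_form g" by simp
  ultimately show "f \<in> sliced_ideal"
    unfolding sliced_ideal_def path_section_def
    using ext_comp_carrier[OF g2] ext_comp_carrier[OF f3] by blast
qed

subsection \<open>Monomials in arbitrary coordinates\<close>

lemmas ext_apply = plus_fun_apply zero_fun_apply ext_scale_apply

(* As simp rules they would turn premises f = g into equations between abstractions. *)
declare ext_apply [simp del]

lemma ext_mult_sum_right: "ext_mult f (\<Sum>i\<in>A. F i) = (\<Sum>i\<in>A. ext_mult f (F i))"
  by (induction A rule: infinite_finite_induct) (simp_all add: ext_mult_add_right)

lemma ext_comp_span_mono:
  assumes "f \<in> ext_comp n d"
  shows "f \<in> ext_vs.span (ext_mono ` {S. S \<subseteq> {..<n} \<and> card S = d})"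
proof -
  let ?A = "{S. S \<subseteq> {..<n} \<and> card S = d}"
  have "f = (\<Sum>S\<in>?A. ext_scale (f S) (ext_mono S))"
  proof
    fix T
    have "(\<Sum>S\<in>?A. f S * ext_mono S T) = (\<Sum>S\<in>?A. if S = T then f T else 0)"
      by (rule sum.cong) (auto simp: ext_mono_def)
    also have "\<dots> = f T" using assms by (auto simp: ext_comp_iff)
    finally show "f T = (\<Sum>S\<in>?A. ext_scale (f S) (ext_mono S)) T" by (simp add: sum_fun_apply ext_apply)
  qed
  also have "\<dots> \<in> ext_vs.span (ext_mono ` ?A)"
    by (intro ext_vs.span_sum ext_vs.span_scale ext_vs.span_base) auto
  finally show ?thesis .
qed

lemma inj_ext_mono: "inj (ext_mono :: nat set \<Rightarrow> 'k::field ext)"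
proof (rule injI)
  fix S T assume "ext_mono S = (ext_mono T :: 'k ext)"
  then have "ext_mono S S = (ext_mono T S :: 'k)" by simp
  then show "S = T" by (simp add: ext_mono_def split: if_splits)
qed

lemma independent_ext_mono:
  assumes "finite A"
  shows "ext_vs.independent (ext_mono ` A :: 'k::field ext set)"
proof (rule ext_vs.independent_if_scalars_zero)
  fix u :: "'k ext \<Rightarrow> 'k" and x :: "'k ext"
  assume 0: "(\<Sum>x\<in>ext_mono ` A. ext_scale (u x) x) = 0" and "x \<in> ext_mono ` A"
  then obtain T where T: "T \<in> A" "x = ext_mono T" by auto
  have "(\<Sum>S\<in>A. ext_scale (u (ext_mono S)) (ext_mono S)) = 0"
    using 0 by (subst (asm) sum.reindex) (auto intro: inj_on_subset[OF inj_ext_mono])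
  then have "(\<Sum>S\<in>A. u (ext_mono S) * ext_mono S T) = 0"
    by (metis (no_types, lifting) ext_scale_apply sum.cong sum_fun_apply zero_fun_apply)
  moreover have "(\<Sum>S\<in>A. u (ext_mono S) * ext_mono S T) = (\<Sum>S\<in>A. if S = T then u x else 0)"
    by (rule sum.cong) (auto simp: ext_mono_def T)
  ultimately show "u x = 0" using assms T by simp
qed (use assms in simp)

text \<open>The form in which dimension enters: the later counts all compare the size of some
  spanning set with the binomial coefficient.\<close>

lemma card_spanning_ext_comp:
  assumes "finite B" "ext_comp n d \<subseteq> ext_vs.span (B :: 'k::field ext set)"
  shows "n choose d \<le> card B"
proof -
  let ?A = "{S. S \<subseteq> {..<n} \<and> card S = d}"
  have fin: "finite ?A" by (rule finite_subset[of _ "Pow {..<n}"]) auto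
  have "ext_mono ` ?A \<subseteq> (ext_comp n d :: 'k ext set)" using ext_mono_comp by auto
  then have sub: "ext_mono ` ?A \<subseteq> ext_vs.span B" using assms(2) by (rule subset_trans)
  have "card (ext_mono ` ?A :: 'k ext set) \<le> card B"
    using ext_vs.independent_span_bound[OF assms(1) independent_ext_mono[OF fin] sub] by simp
  moreover have "card (ext_mono ` ?A :: 'k ext set) = card ?A"
    by (intro card_image inj_on_subset[OF inj_ext_mono]) simp
  ultimately show ?thesis using n_subsets[of "{..<n}" d] by simp
qed

locale monomial_coordinates =
  fixes n :: nat and b :: "nat \<Rightarrow> 'k::field ext" and r :: "(nat set \<times> nat set) set"
  assumes coordinates: "coordinates n b" and monomial_order: "monomial_order n r"
begin

definition list_monomial :: "nat list \<Rightarrow> 'k ext" where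
  "list_monomial xs = foldr (\<lambda>i f. ext_mult (b i) f) xs (ext_const 1)"

definition cmono :: "nat set \<Rightarrow> 'k ext" where
  "cmono S = coord_monomial n b S"

lemma cmono_list: "cmono S = list_monomial (sorted_list_of_set S)"
  by (simp add: cmono_def coord_monomial_def list_monomial_def)

lemma list_monomial_simps [simp]:
  "list_monomial [] = ext_const 1"
  "list_monomial (i # xs) = ext_mult (b i) (list_monomial xs)"
  by (simp_all add: list_monomial_def)

lemma b_comp: "i < n \<Longrightarrow> b i \<in> ext_comp n 1"
  using coordinates by (auto simp: coordinates_def)

lemma b_swap: "i < n \<Longrightarrow> j < n \<Longrightarrow> ext_mult (b j) (ext_mult (b i) f) = - ext_mult (b i) (ext_mult (b j) f)"
proof -
  assume "i < n" "j < n"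
  then have "ext_mult (b j) (b i) = ext_scale (- 1) (ext_mult (b i) (b j))"
    using linear_anticommute[OF b_comp b_comp, of i j] by simp
  then have "ext_mult (b j) (ext_mult (b i) f) = ext_scale (- 1) (ext_mult (b i) (ext_mult (b j) f))"
    by (metis ext_mult_assoc ext_mult_scale_left)
  then show ?thesis by simp
qed

lemma b_square: "i < n \<Longrightarrow> ext_mult (b i) (ext_mult (b i) f) = 0"
  by (simp add: linear_square[OF b_comp] flip: ext_mult_assoc)

lemma list_monomial_mult_mem:
  "set xs \<subseteq> {..<n} \<Longrightarrow> j \<in> set xs \<Longrightarrow> ext_mult (b j) (list_monomial xs) = 0"
proof (induction xs)
  case (Cons i xs)
  then show ?case by (cases "j = i") (auto simp: b_square b_swap[of i j])
qed simp

text \<open>Each transposition contributes a sign; the statement keeps only that the resulting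
  scalar is nonzero.\<close>

lemma list_monomial_mult_insort:
  assumes "j < n"
  shows "set xs \<subseteq> {..<n} \<Longrightarrow>
    \<exists>c. c \<noteq> 0 \<and> ext_mult (b j) (list_monomial xs) = ext_scale c (list_monomial (insort j xs))"
proof (induction xs)
  case Nil
  then show ?case by (intro exI[of _ 1]) simp
next
  case (Cons i xs)
  show ?case
  proof (cases "j \<le> i")
    case True
    then show ?thesis by (intro exI[of _ 1]) simp
  next
    case False
    obtain c where "c \<noteq> 0" "ext_mult (b j) (list_monomial xs) = ext_scale c (list_monomial (insort j xs))"
      using Cons by auto
    then show ?thesis
      using False Cons assms
      by (intro exI[of _ "- c"]) (simp add: b_swap[of i j] ext_mult_scale_right)
  qed
qed

lemma finite_vars: "S \<subseteq> {..<n} \<Longrightarrow> finite S"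
  using finite_subset by blast

lemma b_cmono_mem: "S \<subseteq> {..<n} \<Longrightarrow> j \<in> S \<Longrightarrow> ext_mult (b j) (cmono S) = 0"
  using finite_vars[of S] by (simp add: cmono_list list_monomial_mult_mem)

lemma b_cmono:
  assumes "S \<subseteq> {..<n}" "j < n" "j \<notin> S"
  obtains c where "c \<noteq> 0" "ext_mult (b j) (cmono S) = ext_scale c (cmono (insert j S))"
proof -
  have "finite S" using assms(1) by (rule finite_vars)
  then show ?thesis
    using that list_monomial_mult_insort[OF assms(2), of "sorted_list_of_set S"] assms
    by (auto simp: cmono_list)
qed

lemma cmono_comp: "S \<subseteq> {..<n} \<Longrightarrow> cmono S \<in> ext_comp n (card S)"
proof -
  have "set xs \<subseteq> {..<n} \<Longrightarrow> list_monomial xs \<in> ext_comp n (length xs)" for xs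
  proof (induction xs)
    case Nil
    then show ?case by (auto simp: ext_comp_iff ext_const_def)
  next
    case (Cons i xs)
    then show ?case using ext_comp_linear_mult[OF b_comp] by simp
  qed
  moreover assume "S \<subseteq> {..<n}"
  ultimately show ?thesis using finite_vars[of S]
    by (metis cmono_list length_sorted_list_of_set set_sorted_list_of_set)
qed

text \<open>The unspecified scalar covers both cases: a sign for disjoint sets, and 0 for sets that
  meet.\<close>

lemma cmono_mult:
  assumes "S \<subseteq> {..<n}" "T \<subseteq> {..<n}"
  obtains c where "ext_mult (cmono S) (cmono T) = ext_scale c (cmono (S \<union> T))"
proof -
  have "set xs \<subseteq> {..<n} \<Longrightarrow> \<exists>c. ext_mult (list_monomial xs) (cmono T) = ext_scale c (cmono (set xs \<union> T))" for xs
  proof (induction xs)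
    case Nil
    have "ext_mult (ext_const 1) (cmono T) = cmono T"
      using cmono_comp[OF assms(2)] ext_comp_carrier ext_mult_one_left by blast
    then show ?case by (intro exI[of _ 1]) simp
  next
    case (Cons i xs)
    then obtain c where c: "ext_mult (list_monomial xs) (cmono T) = ext_scale c (cmono (set xs \<union> T))"
      by auto
    let ?U = "set xs \<union> T"
    have "\<exists>d. ext_mult (b i) (cmono ?U) = ext_scale d (cmono (insert i ?U))"
    proof (cases "i \<in> ?U")
      case True
      then show ?thesis using Cons.prems assms(2) by (intro exI[of _ 0]) (simp add: b_cmono_mem)
    next
      case False
      then show ?thesis using b_cmono[of ?U i] Cons.prems assms(2) by fastforce
    qed
    then show ?case using c by (auto simp: ext_mult_assoc ext_mult_scale_right)
  qed
  then show ?thesis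
    using that finite_vars[OF assms(1)] assms(1) by (metis cmono_list set_sorted_list_of_set)
qed

lemma cmono_empty: "cmono {} = ext_const 1"
  by (simp add: cmono_list)

lemma b_mult_span:
  assumes "i < n" "x \<in> ext_vs.span (cmono ` {S. S \<subseteq> {..<n} \<and> card S = d})"
  shows "ext_mult (b i) x \<in> ext_vs.span (cmono ` {S. S \<subseteq> {..<n} \<and> card S = Suc d})"
  using assms(2)
proof (induction rule: ext_vs.span_induct_alt)
  case base
  then show ?case by (simp add: ext_vs.span_zero)
next
  case (step c x y)
  then obtain S where S: "x = cmono S" "S \<subseteq> {..<n}" "card S = d" by auto
  have "ext_mult (b i) x \<in> ext_vs.span (cmono ` {S. S \<subseteq> {..<n} \<and> card S = Suc d})"
  proof (cases "i \<in> S")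
    case True
    then show ?thesis using S by (simp add: b_cmono_mem ext_vs.span_zero)
  next
    case False
    obtain e where "ext_mult (b i) (cmono S) = ext_scale e (cmono (insert i S))"
      using b_cmono[OF S(2) assms(1) False] .
    moreover have "cmono (insert i S) \<in> ext_vs.span (cmono ` {S. S \<subseteq> {..<n} \<and> card S = Suc d})"
      using S False finite_vars[OF S(2)] assms(1) by (intro ext_vs.span_base imageI) auto
    ultimately show ?thesis using S by (auto intro: ext_vs.span_scale)
  qed
  then show ?case
    using step by (auto simp: ext_mult_add_right ext_mult_scale_right
      intro!: ext_vs.span_add ext_vs.span_scale)
qed

text \<open>Up to sign, e_S is e_j times e_(S - {j}). The second factor is expanded by induction on
  the degree, and e_j by the definition of coordinates.\<close>

lemma ext_comp_span_cmono: "ext_comp n d \<subseteq> ext_vs.span (cmono ` {S. S \<subseteq> {..<n} \<and> card S = d})"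
proof -
  have mono: "S \<subseteq> {..<n} \<Longrightarrow> card S = d \<Longrightarrow>
    ext_mono S \<in> ext_vs.span (cmono ` {S. S \<subseteq> {..<n} \<and> card S = d})" for S
  proof (induction d arbitrary: S)
    case 0
    then have "S = {}" using finite_vars[of S] by simp
    moreover have "ext_mono {} = cmono {}" by (simp add: cmono_empty ext_const_eq)
    ultimately show ?case by (auto intro!: ext_vs.span_base)
  next
    case (Suc d)
    let ?V = "ext_vs.span (cmono ` {S. S \<subseteq> {..<n} \<and> card S = Suc d})"
    have fin: "finite S" using Suc.prems(1) by (rule finite_vars)
    obtain j where j: "j \<in> S" using Suc.prems by fastforce
    let ?x = "ext_mono (S - {j}) :: 'k ext"
    have x: "?x \<in> ext_vs.span (cmono ` {S. S \<subseteq> {..<n} \<and> card S = d})"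
      using Suc j fin by (intro Suc.IH) auto
    have "ext_mono {j} \<in> (ext_comp n 1 :: 'k ext set)"
      using ext_mono_comp[of "{j}" n] j Suc.prems by auto
    then obtain c where c: "ext_mono {j} = (\<lambda>S. \<Sum>i<n. c i * b i S)"
      using coordinates unfolding coordinates_def by blast
    have "ext_mono {j} = (\<Sum>i<n. ext_scale (c i) (b i))"
      unfolding c by (simp add: fun_eq_iff sum_fun_apply ext_apply)
    moreover have "ext_mult (\<Sum>i<k. ext_scale (c i) (b i)) ?x \<in> ?V" if "k \<le> n" for k
      using that
    proof (induction k)
      case (Suc k)
      then show ?case
        using b_mult_span[OF _ x, of k]
        by (auto simp: ext_mult_add_left ext_mult_scale_left intro!: ext_vs.span_add ext_vs.span_scale)
    qed (simp add: ext_vs.span_zero)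
    ultimately have "ext_mult (ext_mono {j}) ?x \<in> ?V" by simp
    moreover have "ext_mult (ext_mono {j}) ?x = ext_scale (ext_sign {j} (S - {j})) (ext_mono S)"
      using fin j by (simp add: ext_mono_mult insert_absorb)
    ultimately have "ext_scale (ext_sign {j} (S - {j})) (ext_mono S) \<in> ?V" by simp
    then have "ext_scale (1 / ext_sign {j} (S - {j}))
        (ext_scale (ext_sign {j} (S - {j})) (ext_mono S)) \<in> ?V"
      by (rule ext_vs.span_scale)
    then show ?case by simp
  qed
  have "ext_vs.span (ext_mono ` {S. S \<subseteq> {..<n} \<and> card S = d}) \<subseteq>
      ext_vs.span (cmono ` {S. S \<subseteq> {..<n} \<and> card S = d})"
    by (rule ext_vs.span_minimal[OF _ ext_vs.subspace_span]) (use mono in auto)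
  then show ?thesis using ext_comp_span_mono by blast
qed

text \<open>The coordinate monomials of degree \<open>d\<close> span and are indexed by
  \<open>n choose d\<close> sets; a nontrivial relation would let one be dropped, leaving too few to
  span.\<close>

lemma cmono_independent:
  assumes 0: "(\<Sum>S | S \<subseteq> {..<n} \<and> card S = d. ext_scale (c S) (cmono S)) = 0"
    and M: "M \<subseteq> {..<n}" "card M = d"
  shows "c M = 0"
proof (rule ccontr)
  assume cM: "c M \<noteq> 0"
  let ?A = "{S. S \<subseteq> {..<n} \<and> card S = d}"
  have fin: "finite ?A" by (rule finite_subset[of _ "Pow {..<n}"]) auto
  have "ext_scale (c M) (cmono M) + (\<Sum>S\<in>?A - {M}. ext_scale (c S) (cmono S)) = 0"
    using 0 fin M by (simp add: sum.remove[of ?A M])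
  then have "ext_scale (c M) (cmono M) = - (\<Sum>S\<in>?A - {M}. ext_scale (c S) (cmono S))"
    by (rule eq_neg_iff_add_eq_0[THEN iffD2])
  also have "\<dots> \<in> ext_vs.span (cmono ` (?A - {M}))"
    by (intro ext_vs.span_neg ext_vs.span_sum ext_vs.span_scale ext_vs.span_base) auto
  finally have "ext_scale (1 / c M) (ext_scale (c M) (cmono M)) \<in> ext_vs.span (cmono ` (?A - {M}))"
    by (rule ext_vs.span_scale)
  then have "cmono M \<in> ext_vs.span (cmono ` (?A - {M}))" using cM by simp
  then have "cmono ` ?A \<subseteq> ext_vs.span (cmono ` (?A - {M}))"
    by (auto intro: ext_vs.span_base)
  then have "ext_vs.span (cmono ` ?A) \<subseteq> ext_vs.span (cmono ` (?A - {M}))"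
    by (rule ext_vs.span_minimal[OF _ ext_vs.subspace_span])
  then have "n choose d \<le> card (cmono ` (?A - {M}))"
    using fin ext_comp_span_cmono by (intro card_spanning_ext_comp) auto
  also have "\<dots> \<le> card (?A - {M})" using fin by (intro card_image_le) auto
  also have "\<dots> < card ?A" using fin M by (intro psubset_card_mono) auto
  also have "\<dots> = n choose d" using n_subsets[of "{..<n}" d] by simp
  finally show False by simp
qed

subsection \<open>Leading terms\<close>

definition leads :: "nat set \<Rightarrow> 'k ext \<Rightarrow> (nat set \<Rightarrow> 'k) \<Rightarrow> bool" where
  "leads M f c \<longleftrightarrow> f = (\<Sum>S\<in>Pow {..<n}. ext_scale (c S) (cmono S)) \<and> M \<subseteq> {..<n} \<and> c M \<noteq> 0 \<and>
    (\<forall>S\<in>Pow {..<n}. c S \<noteq> 0 \<longrightarrow> (S, M) \<in> r)"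

lemma leading_term_iff:
  "leading_term n b r f t \<longleftrightarrow> (\<exists>c M. leads M f c \<and> t = ext_scale (c M) (cmono M))"
proof -
  have 1: "(\<lambda>U. \<Sum>S\<in>Pow {..<n}. c S * coord_monomial n b S U) =
      (\<Sum>S\<in>Pow {..<n}. ext_scale (c S) (cmono S))" for c
    by (simp add: fun_eq_iff sum_fun_apply ext_apply cmono_def)
  have 2: "(\<lambda>U. c * coord_monomial n b M U) = ext_scale c (cmono M)" for c M
    by (simp add: fun_eq_iff ext_apply cmono_def)
  show ?thesis unfolding leading_term_def 1 2 leads_def by blast
qed

text \<open>The position in the order, as a number: it supports induction along the order and the
  choice of a least monomial.\<close>

definition order_rank :: "nat set \<Rightarrow> nat" where
  "order_rank S = card {T. T \<subseteq> {..<n} \<and> (T, S) \<in> r}"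

lemma linear_order: "linear_order_on (Pow {..<n}) r"
  using monomial_order by (simp add: monomial_order_def)

lemma order_antisym: "(S, T) \<in> r \<Longrightarrow> (T, S) \<in> r \<Longrightarrow> S = T"
  using linear_order by (auto simp: linear_order_on_def partial_order_on_def antisym_def)

lemma order_total: "S \<subseteq> {..<n} \<Longrightarrow> T \<subseteq> {..<n} \<Longrightarrow> S \<noteq> T \<Longrightarrow> (S, T) \<in> r \<or> (T, S) \<in> r"
  using linear_order by (auto simp: linear_order_on_def total_on_def)

lemma order_refl: "S \<subseteq> {..<n} \<Longrightarrow> (S, S) \<in> r"
  using linear_order
  by (auto simp: linear_order_on_def partial_order_on_def preorder_on_def refl_on_def)

lemma order_insert:
  assumes "(S, T) \<in> r" "S \<noteq> T" "S \<subseteq> {..<n}" "T \<subseteq> {..<n}" "j < n" "j \<notin> S" "j \<notin> T"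
  shows "(insert j S, insert j T) \<in> r" "insert j S \<noteq> insert j T"
proof -
  have step: "\<forall>S\<in>Pow {..<n}. \<forall>T\<in>Pow {..<n}. \<forall>U\<in>Pow {..<n}.
      (S, T) \<in> r \<and> S \<noteq> T \<and> S \<inter> U = {} \<and> T \<inter> U = {} \<longrightarrow> (S \<union> U, T \<union> U) \<in> r \<and> S \<union> U \<noteq> T \<union> U"
    using monomial_order unfolding monomial_order_def by (elim conjE)
  have "(S \<union> {j}, T \<union> {j}) \<in> r \<and> S \<union> {j} \<noteq> T \<union> {j}"
    using assms by (intro step[rule_format]) auto
  then show "(insert j S, insert j T) \<in> r" "insert j S \<noteq> insert j T" by auto
qed

lemma order_rank_less:
  assumes "(S, T) \<in> r" "S \<noteq> T" "T \<subseteq> {..<n}"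
  shows "order_rank S < order_rank T"
  unfolding order_rank_def
proof (rule psubset_card_mono)
  show "finite {U. U \<subseteq> {..<n} \<and> (U, T) \<in> r}" by (rule finite_subset[of _ "Pow {..<n}"]) auto
  have "trans r"
    using linear_order by (simp add: linear_order_on_def partial_order_on_def preorder_on_def)
  then have "{U. U \<subseteq> {..<n} \<and> (U, S) \<in> r} \<subseteq> {U. U \<subseteq> {..<n} \<and> (U, T) \<in> r}"
    using assms(1) by (auto dest: transD)
  moreover have "T \<notin> {U. U \<subseteq> {..<n} \<and> (U, S) \<in> r}" using assms order_antisym by blast
  moreover have "T \<in> {U. U \<subseteq> {..<n} \<and> (U, T) \<in> r}" using assms(3) order_refl by simp
  ultimately show "{U. U \<subseteq> {..<n} \<and> (U, S) \<in> r} \<subset> {U. U \<subseteq> {..<n} \<and> (U, T) \<in> r}"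
    by blast
qed

lemma finite_degree: "finite {S. S \<subseteq> {..<n} \<and> P S}"
  by (rule finite_subset[of _ "Pow {..<n}"]) auto

lemma ext_part_cmono: "S \<subseteq> {..<n} \<Longrightarrow> ext_part d (cmono S) = (if card S = d then cmono S else 0)"
  using ext_part_of_comp[OF cmono_comp] by simp

lemma ext_part_expansion:
  "ext_part d (\<Sum>S\<in>Pow {..<n}. ext_scale (c S) (cmono S)) =
    (\<Sum>S | S \<subseteq> {..<n} \<and> card S = d. ext_scale (c S) (cmono S))"
proof -
  have "ext_part d (\<Sum>S\<in>Pow {..<n}. ext_scale (c S) (cmono S)) =
      (\<Sum>S\<in>Pow {..<n}. if card S = d then ext_scale (c S) (cmono S) else 0)"
    unfolding ext_part_sum ext_part_scale by (rule sum.cong) (simp_all add: ext_part_cmono)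
  also have "\<dots> = (\<Sum>S | S \<subseteq> {..<n} \<and> card S = d. ext_scale (c S) (cmono S))"
    using sum.inter_filter[of "Pow {..<n}" "\<lambda>S. ext_scale (c S) (cmono S)" "\<lambda>S. card S = d"]
    by simp
  finally show ?thesis .
qed

lemma leads_part:
  assumes "leads M f c"
  shows "ext_part (card M) f = ext_scale (c M) (cmono M) +
    (\<Sum>S | S \<subseteq> {..<n} \<and> card S = card M \<and> S \<noteq> M. ext_scale (c S) (cmono S))"
proof -
  have f: "f = (\<Sum>S\<in>Pow {..<n}. ext_scale (c S) (cmono S))" and M: "M \<subseteq> {..<n}"
    using assms by (simp_all add: leads_def)
  have "{S. S \<subseteq> {..<n} \<and> card S = card M} - {M} = {S. S \<subseteq> {..<n} \<and> card S = card M \<and> S \<noteq> M}"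
    by auto
  then show ?thesis
    unfolding f ext_part_expansion
    using M by (subst sum.remove[of _ M]) (auto simp: finite_degree)
qed

text \<open>The expansion in \<open>leads\<close> runs over all degrees, so homogeneity has to be
  transferred to its coefficients by independence.\<close>

lemma leads_comp_card:
  assumes lead: "leads M f c" and f: "f \<in> ext_comp n d"
  shows "card M = d"
proof (rule ccontr)
  assume ne: "card M \<noteq> d"
  have e: "f = (\<Sum>S\<in>Pow {..<n}. ext_scale (c S) (cmono S))" and M: "M \<subseteq> {..<n}" "c M \<noteq> 0"
    using lead by (simp_all add: leads_def)
  have "ext_part (card M) f = 0" using f ne by (simp add: ext_part_of_comp)
  then have "c M = 0" using M unfolding e ext_part_expansion by (intro cmono_independent) auto
  then show False using M by simp
qed

definition leading_sets :: "nat \<Rightarrow> 'k ext set \<Rightarrow> nat set set" where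
  "leading_sets d J = {M. card M = d \<and> (\<exists>f\<in>J. \<exists>c. leads M f c)}"

text \<open>One half of Macaulay's basis theorem. A leading monomial is, modulo \<open>J\<close>, a
  combination of smaller ones of the same degree; by induction along the order, standard monomials
  together with the degree \<open>d\<close> piece of \<open>J\<close> span everything.\<close>

lemma card_standard_monomials:
  assumes J: "graded_ideal n J" and B: "finite B" "J \<inter> ext_comp n d \<subseteq> ext_vs.span B"
  shows "n choose d \<le> card {S. S \<subseteq> {..<n} \<and> card S = d \<and> S \<notin> leading_sets d J} + card B"
proof -
  let ?E = "{S. S \<subseteq> {..<n} \<and> card S = d \<and> S \<notin> leading_sets d J}"
  let ?V = "ext_vs.span (cmono ` ?E \<union> B)"
  have "S \<subseteq> {..<n} \<Longrightarrow> card S = d \<Longrightarrow> cmono S \<in> ?V" for S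
  proof (induction "order_rank S" arbitrary: S rule: less_induct)
    case less
    show ?case
    proof (cases "S \<in> leading_sets d J")
      case False
      then show ?thesis using less.prems by (intro ext_vs.span_base) auto
    next
      case True
      then obtain f c where f: "f \<in> J" "leads S f c" by (auto simp: leading_sets_def)
      let ?rest = "\<Sum>T | T \<subseteq> {..<n} \<and> card T = card S \<and> T \<noteq> S. ext_scale (c T) (cmono T)"
      have "?rest \<in> ?V"
      proof (rule ext_vs.span_sum)
        fix T assume T: "T \<in> {T. T \<subseteq> {..<n} \<and> card T = card S \<and> T \<noteq> S}"
        show "ext_scale (c T) (cmono T) \<in> ?V"
        proof (cases "c T = 0")
          case False
          then have "(T, S) \<in> r" using T f(2) by (auto simp: leads_def)
          then have "order_rank T < order_rank S" using T less.prems by (intro order_rank_less) auto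
          then show ?thesis using T less by (intro ext_vs.span_scale less.hyps) auto
        qed (simp add: ext_vs.span_zero)
      qed
      moreover have "ext_part d f \<in> ?V"
      proof -
        have "f \<in> carrier (ext_alg n)"
          using J f(1) ideal_ext_algD(1) unfolding graded_ideal_def by blast
        then have "ext_part d f \<in> J \<inter> ext_comp n d"
          using J f(1) ext_part_comp by (auto simp: graded_ideal_def ext_part_def)
        then show ?thesis using B(2) ext_vs.span_mono[of B "cmono ` ?E \<union> B"] by auto
      qed
      moreover have "ext_scale (c S) (cmono S) = ext_part d f - ?rest"
        using leads_part[OF f(2)] less.prems by simp
      ultimately have "ext_scale (c S) (cmono S) \<in> ?V" by (simp add: ext_vs.span_diff)
      then have "ext_scale (1 / c S) (ext_scale (c S) (cmono S)) \<in> ?V" by (rule ext_vs.span_scale)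
      then show ?thesis using f(2) by (simp add: leads_def)
    qed
  qed
  then have "ext_vs.span (cmono ` {S. S \<subseteq> {..<n} \<and> card S = d}) \<subseteq> ?V"
    by (intro ext_vs.span_minimal[OF _ ext_vs.subspace_span]) auto
  then have "n choose d \<le> card (cmono ` ?E \<union> B)"
    using ext_comp_span_cmono B(1) by (intro card_spanning_ext_comp) (auto simp: finite_degree)
  also have "\<dots> \<le> card (cmono ` ?E) + card B" by (rule card_Un_le)
  also have "card (cmono ` ?E) \<le> card ?E" by (rule card_image_le) (rule finite_degree)
  finally show ?thesis by simp
qed

text \<open>The monomial ideal generated by \<open>N\<close> in the given coordinates. A product of
  monomials is a scalar multiple of the monomial of the union, which still contains a member of
  \<open>N\<close>.\<close>

lemma monomial_span_ideal:
  "ideal (ext_vs.span (cmono ` {S. S \<subseteq> {..<n} \<and> (\<exists>M\<in>N. M \<subseteq> S)})) (ext_alg n)"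
    (is "ideal (ext_vs.span (cmono ` ?A)) _")
proof (rule ideal_ext_algI)
  let ?V = "ext_vs.span (cmono ` ?A)"
  have sub: "ext_vs.subspace (carrier (ext_alg n))"
    by (rule ext_vs.subspaceI) (auto intro: carrier_ext_alg_add carrier_ext_alg_scale)
  show "?V \<subseteq> carrier (ext_alg n)"
    by (rule ext_vs.span_minimal[OF _ sub]) (auto intro: ext_comp_carrier cmono_comp)
  show "0 \<in> ?V" by (rule ext_vs.span_zero)
  show "f + g \<in> ?V" if "f \<in> ?V" "g \<in> ?V" for f g using that by (rule ext_vs.span_add)
  have all: "carrier (ext_alg n) \<subseteq> ext_vs.span (cmono ` Pow {..<n})"
  proof
    fix f :: "'k ext" assume f: "f \<in> carrier (ext_alg n)"
    have "f = (\<Sum>d\<le>n. ext_part d f)"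
    proof
      fix S
      have "(\<Sum>d\<le>n. if card S = d then f S else 0) = f S"
        using f card_mono[of "{..<n}" S] by (auto simp: carrier_ext_alg)
      then show "f S = (\<Sum>d\<le>n. ext_part d f) S" by (simp add: sum_fun_apply ext_part_def)
    qed
    moreover have "ext_part d f \<in> ext_vs.span (cmono ` Pow {..<n})" for d
    proof -
      have "cmono ` {S. S \<subseteq> {..<n} \<and> card S = d} \<subseteq> cmono ` Pow {..<n}" by auto
      then show ?thesis
        using ext_part_comp[OF f, of d] ext_comp_span_cmono[of d] ext_vs.span_mono by blast
    qed
    ultimately show "f \<in> ext_vs.span (cmono ` Pow {..<n})" by (metis ext_vs.span_sum)
  qed
  have "ext_mult f g \<in> ?V \<and> ext_mult g f \<in> ?V"
    if f: "f \<in> ?V" and g: "g \<in> ext_vs.span (cmono ` Pow {..<n})" for f g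
    using f
  proof (induction rule: ext_vs.span_induct_alt)
    case (step c x y)
    then obtain S M where S: "x = cmono S" "S \<subseteq> {..<n}" "M \<in> N" "M \<subseteq> S" by auto
    have "ext_mult x g \<in> ?V \<and> ext_mult g x \<in> ?V"
      using g
    proof (induction rule: ext_vs.span_induct_alt)
      case (step e z w)
      then obtain T where T: "z = cmono T" "T \<subseteq> {..<n}" by auto
      obtain p q where pq: "ext_mult x z = ext_scale p (cmono (S \<union> T))"
        "ext_mult z x = ext_scale q (cmono (T \<union> S))"
        unfolding S(1) T(1) using cmono_mult[OF S(2) T(2)] cmono_mult[OF T(2) S(2)] by metis
      have "S \<union> T \<in> ?A" using S T by auto
      then have "cmono (S \<union> T) \<in> ?V" by (intro ext_vs.span_base imageI)
      then have "ext_mult x z \<in> ?V" "ext_mult z x \<in> ?V"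
        unfolding pq by (simp_all add: Un_commute ext_vs.span_scale)
      then show ?case
        using step by (simp add: ext_mult_add_left ext_mult_add_right ext_mult_scale_left
          ext_mult_scale_right ext_vs.span_add ext_vs.span_scale)
    qed (simp add: ext_vs.span_zero)
    then show ?case
      using step by (simp add: ext_mult_add_left ext_mult_add_right ext_mult_scale_left
        ext_mult_scale_right ext_vs.span_add ext_vs.span_scale)
  qed (simp add: ext_vs.span_zero)
  then show "ext_mult g f \<in> ?V" "ext_mult f g \<in> ?V"
    if "f \<in> ?V" "g \<in> carrier (ext_alg n)" for f g
    using that all by blast+
qed

lemma ext_part_monomial_span:
  assumes "A \<subseteq> Pow {..<n}" "x \<in> ext_vs.span (cmono ` A)"
  shows "ext_part d x \<in> ext_vs.span (cmono ` {S \<in> A. card S = d})"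
  using assms(2)
proof (induction rule: ext_vs.span_induct_alt)
  case (step c x y)
  then obtain S where S: "x = cmono S" "S \<in> A" by auto
  then have "ext_part d x \<in> ext_vs.span (cmono ` {S \<in> A. card S = d})"
  proof -
    have "S \<subseteq> {..<n}" using S(2) assms(1) by auto
    then show ?thesis
      using S by (auto simp: ext_part_cmono intro: ext_vs.span_zero ext_vs.span_base)
  qed
  then show ?case
    using step by (simp add: ext_part_add ext_part_scale ext_vs.span_add ext_vs.span_scale)
qed (simp add: ext_vs.span_zero)

text \<open>Leading terms of elements of \<open>G\<close> have degree \<open>e\<close>, hence lie in
  the monomial ideal of \<open>leading_sets e J\<close>, which then contains the ideal they
  generate. The conclusion is a span rather than divisibility by some \<open>M\<close>; a dimension
  count makes up for the difference.\<close>

lemma quadratic_lt_ideal: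
  assumes G: "G \<subseteq> J" "G \<subseteq> ext_comp n e" and x: "cmono S \<in> lt_ideal n b r G"
    and S: "S \<subseteq> {..<n}" "card S = d"
  shows "cmono S \<in> ext_vs.span (cmono ` {T. T \<subseteq> {..<n} \<and> (\<exists>M\<in>leading_sets e J. M \<subseteq> T) \<and> card T = d})"
proof -
  let ?A = "{T. T \<subseteq> {..<n} \<and> (\<exists>M\<in>leading_sets e J. M \<subseteq> T)}"
  have "{t. \<exists>f\<in>G. leading_term n b r f t} \<subseteq> ext_vs.span (cmono ` ?A)"
  proof clarify
    fix t f assume f: "f \<in> G" "leading_term n b r f t"
    then obtain c M where M: "leads M f c" "t = ext_scale (c M) (cmono M)"
      by (auto simp: leading_term_iff)
    then have "M \<in> leading_sets e J"
      using f(1) G leads_comp_card[OF M(1)] by (auto simp: leading_sets_def)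
    moreover have "M \<subseteq> {..<n}" using M(1) by (simp add: leads_def)
    ultimately show "t \<in> ext_vs.span (cmono ` ?A)"
      unfolding M(2) by (intro ext_vs.span_scale ext_vs.span_base) auto
  qed
  then have "lt_ideal n b r G \<subseteq> ext_vs.span (cmono ` ?A)"
    unfolding lt_ideal_def genideal_def using monomial_span_ideal[of "leading_sets e J"] by blast
  then have "ext_part d (cmono S) \<in> ext_vs.span (cmono ` {T \<in> ?A. card T = d})"
    using x by (intro ext_part_monomial_span) auto
  then show ?thesis using S by (simp add: ext_part_cmono conj_assoc)
qed

lemma leads_cmono_diff:
  assumes S: "S \<subseteq> {..<n}" "T \<subseteq> {..<n}" "S \<noteq> T" and c: "c \<noteq> 0 \<Longrightarrow> (T, S) \<in> r"
  shows "leads S (cmono S + ext_scale c (cmono T)) (\<lambda>U. if U = S then 1 else if U = T then c else 0)"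
    (is "leads S ?f ?c")
proof -
  have "(\<Sum>U\<in>Pow {..<n}. ext_scale (?c U) (cmono U)) = (\<Sum>U\<in>{S, T}. ext_scale (?c U) (cmono U))"
    using S by (intro sum.mono_neutral_right) auto
  also have "\<dots> = ?f" using S(3) by simp
  finally show ?thesis using S c order_refl by (auto simp: leads_def)
qed

end

subsection \<open>The Hilbert function obstruction\<close>

text \<open>Pairs outside \<open>N\<close> are the edges of a graph whose only triangle is
  \<open>S0\<close>. The bound is 3 + 3 + 2: edges inside \<open>S0\<close>, edges between
  \<open>S0\<close> and the rest, edges within the rest.\<close>

lemma triangle_count:
  assumes N: "\<And>M. M \<in> N \<Longrightarrow> card M = 2"
    and tri: "{T. T \<subseteq> {..<6} \<and> card T = 3 \<and> \<not> (\<exists>M\<in>N. M \<subseteq> T)} = {S0}"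
  shows "card {S. S \<subseteq> {..<6::nat} \<and> card S = 2 \<and> S \<notin> N} \<le> 8"
proof -
  let ?E = "{S. S \<subseteq> {..<6::nat} \<and> card S = 2 \<and> S \<notin> N}"
  let ?R = "{..<6} - S0"
  define X where "X v = {e \<in> ?E. v \<in> e \<and> e \<inter> S0 \<noteq> {}}" for v
  have S0: "S0 \<subseteq> {..<6}" "card S0 = 3" "\<And>M. M \<in> N \<Longrightarrow> \<not> M \<subseteq> S0" using tri by auto
  have unique: "T = S0" if "T \<subseteq> {..<6}" "card T = 3" "\<And>M. M \<in> N \<Longrightarrow> \<not> M \<subseteq> T" for T
    using tri that by blast
  have finS0: "finite S0" using S0(1) finite_subset by blast
  have R: "card ?R = 3" using S0 finS0 by (simp add: card_Diff_subset)
  have fin: "finite {S. S \<subseteq> {..<6::nat} \<and> P S}" for P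
    by (rule finite_subset[of _ "Pow {..<6}"]) auto
  have pairs: "card {e. e \<subseteq> A \<and> card e = 2} = 3" if "finite A" "card A = 3" for A :: "nat set"
    using n_subsets[OF that(1), of 2] that(2) by (simp add: numeral_eq_Suc)
  have X1: "card (X v) \<le> 1" if v: "v \<in> ?R" for v
  proof -
    have "e = e'" if e: "e \<in> X v" and e': "e' \<in> X v" for e e'
    proof (rule ccontr)
      assume ne: "e \<noteq> e'"
      have "\<exists>p\<in>S0. d = {v, p}" if dX: "d \<in> X v" for d
      proof -
        obtain p where p: "p \<in> d" "p \<in> S0" using dX by (auto simp: X_def)
        have d: "card d = 2" "v \<in> d" using dX by (auto simp: X_def)
        have "p \<noteq> v" using p v by auto
        moreover have "finite d" using d(1) by (auto intro: card_ge_0_finite)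
        ultimately have "{v, p} = d" using d p by (intro card_subset_eq) auto
        then show ?thesis using p by auto
      qed
      then obtain p q where pq: "p \<in> S0" "q \<in> S0" "e = {v, p}" "e' = {v, q}" using e e' by meson
      have dist: "p \<noteq> q" "v \<noteq> p" "v \<noteq> q" using pq ne v by auto
      \<comment> \<open>Two edges from \<open>v\<close> into \<open>S0\<close> would close up with
        an edge of \<open>S0\<close> to a second triangle.\<close>
      have "{v, p, q} = S0"
      proof (rule unique)
        show "{v, p, q} \<subseteq> {..<6}" using v pq S0(1) by auto
        show "card {v, p, q} = 3" using dist by simp
        fix M assume M: "M \<in> N"
        show "\<not> M \<subseteq> {v, p, q}"
        proof
          assume sub: "M \<subseteq> {v, p, q}"
          obtain x y where "M = {x, y}" "x \<noteq> y" using N[OF M] by (auto simp: card_2_iff)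
          then have "M = {v, p} \<or> M = {v, q} \<or> M = {p, q}" using sub by auto
          then show False using M S0(3)[OF M] pq e e' by (auto simp: X_def)
        qed
      qed
      then show False using v by auto
    qed
    then show ?thesis
      using fin card_le_Suc0_iff_eq[of "X v"] by (simp add: X_def)
  qed
  \<comment> \<open>All three pairs being edges would make the complement of \<open>S0\<close> a
    triangle.\<close>
  have R2: "card {e \<in> ?E. e \<subseteq> ?R} \<le> 2"
  proof (rule ccontr)
    assume "\<not> card {e \<in> ?E. e \<subseteq> ?R} \<le> 2"
    then have "card {e. e \<subseteq> ?R \<and> card e = 2} \<le> card {e \<in> ?E. e \<subseteq> ?R}"
      using pairs[OF _ R] by simp
    moreover have "finite {e. e \<subseteq> ?R \<and> card e = 2}" by (rule finite_subset[of _ "Pow ?R"]) auto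
    ultimately have "{e \<in> ?E. e \<subseteq> ?R} = {e. e \<subseteq> ?R \<and> card e = 2}"
      by (intro card_seteq) auto
    then have "?R = S0" using N by (intro unique R) auto
    then show False using S0(2) by (metis Diff_disjoint card.empty inf.idem zero_neq_numeral)
  qed
  have "?E \<subseteq> {e. e \<subseteq> S0 \<and> card e = 2} \<union> (\<Union>v\<in>?R. X v) \<union> {e \<in> ?E. e \<subseteq> ?R}"
    by (auto simp: X_def)
  then have "card ?E \<le> card ({e. e \<subseteq> S0 \<and> card e = 2} \<union> (\<Union>v\<in>?R. X v) \<union> {e \<in> ?E. e \<subseteq> ?R})"
    using finS0 fin by (intro card_mono) (auto simp: X_def)
  also have "\<dots> \<le> card {e. e \<subseteq> S0 \<and> card e = 2} + card (\<Union>v\<in>?R. X v) + card {e \<in> ?E. e \<subseteq> ?R}"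
    by (intro order_trans[OF card_Un_le] add_right_mono card_Un_le)
  also have "card (\<Union>v\<in>?R. X v) \<le> (\<Sum>v\<in>?R. card (X v))" by (rule card_UN_le) simp
  also have "\<dots> \<le> 3" using sum_mono[of ?R "\<lambda>v. card (X v)" "\<lambda>_. 1"] X1 R by simp
  finally show ?thesis using pairs[OF finS0 S0(2)] R2 by linarith
qed

lemma not_G_quadratic_sliced_ideal: "\<not> G_quadratic 6 (sliced_ideal :: 'k::field ext set)"
proof
  let ?J = "sliced_ideal :: 'k ext set"
  let ?U = "{0, 2, 4} :: nat set"
  assume "G_quadratic 6 ?J"
  then obtain b r G where b: "coordinates 6 b" "monomial_order 6 r"
    and G: "groebner_basis 6 b r ?J G" "G \<subseteq> ext_comp 6 2"
    by (auto simp: G_quadratic_def)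
  interpret monomial_coordinates 6 b r by standard (fact b)+
  define N where "N = leading_sets 2 ?J"
  let ?A = "{S. S \<subseteq> {..<6::nat} \<and> card S = 3}"
  have cardA: "card ?A = 20" using n_subsets[of "{..<6::nat}" 3] by (simp add: numeral_eq_Suc)

  have "\<exists>S. S \<in> ?A \<and> cmono S ?U \<noteq> 0"
  proof (rule ccontr)
    assume "\<not> ?thesis"
    then have "cmono ` ?A \<subseteq> {f. f ?U = 0}" by auto
    moreover have "ext_vs.subspace {f :: 'k ext. f ?U = 0}"
      by (rule ext_vs.subspaceI) (auto simp: ext_apply)
    ultimately have "ext_vs.span (cmono ` ?A) \<subseteq> {f. f ?U = 0}" by (rule ext_vs.span_minimal)
    moreover have "ext_mono ?U \<in> ext_vs.span (cmono ` ?A)"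
      using ext_comp_span_cmono[of 3] ext_mono_comp[of ?U 6] by (auto simp: numeral_3_eq_3)
    ultimately show False by (auto simp: ext_mono_def)
  qed
  then obtain S1 where S1: "S1 \<in> ?A \<and> cmono S1 ?U \<noteq> 0" ..
  \<comment> \<open>The cubic piece of the ideal is the kernel of the coefficient functional at
    \<open>?U\<close>. The coordinate monomials span the cubics, so the functional is nonzero on
    some of them, and the least such monomial will be the unique standard cubic.\<close>
  define S0 where "S0 = arg_min order_rank (\<lambda>S. S \<in> ?A \<and> cmono S ?U \<noteq> 0)"
  have S0: "S0 \<in> ?A" "cmono S0 ?U \<noteq> 0"
    and least: "\<And>S. S \<in> ?A \<Longrightarrow> cmono S ?U \<noteq> 0 \<Longrightarrow> order_rank S0 \<le> order_rank S"
    using arg_min_nat_lemma[of "\<lambda>S. S \<in> ?A \<and> cmono S ?U \<noteq> 0", OF S1, of order_rank]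
    unfolding S0_def by simp_all
  have below: "cmono S ?U = 0" if "S \<in> ?A" "(S, S0) \<in> r" "S \<noteq> S0" for S
    using least[OF that(1)] order_rank_less[OF that(2,3)] S0(1) by fastforce

  \<comment> \<open>If \<open>M\<close> led \<open>f\<close> and \<open>S0\<close> were
    \<open>M\<close> with \<open>j\<close> added, then b_j f would lie in the ideal with
    \<open>S0\<close> as its largest cubic monomial; the functional would see only that monomial and
    not vanish.\<close>
  have S0_standard: "\<not> M \<subseteq> S0" if M: "M \<in> N" for M
  proof
    assume sub: "M \<subseteq> S0"
    obtain f c where f: "f \<in> ?J" "leads M f c" and M2: "card M = 2"
      using M by (auto simp: N_def leading_sets_def)
    have finS0: "finite S0" using S0(1) finite_vars by auto
    have "M \<noteq> S0" using M2 S0(1) by auto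
    then obtain j where j: "j \<in> S0" "j \<notin> M" using sub by auto
    have M6: "M \<subseteq> {..<6}" and j6: "j < 6" using sub S0(1) j by auto
    have S0_eq: "insert j M = S0"
      using j sub M2 S0(1) finS0 finite_subset[OF sub] by (intro card_subset_eq) auto
    have fc: "f \<in> carrier (ext_alg 6)" using f(1) ideal_ext_algD(1)[OF ideal_sliced_ideal] by auto
    have "ext_mult (b j) f \<in> ?J"
      using f(1) ext_comp_carrier[OF b_comp[OF j6]] by (rule ideal_ext_algD(4)[OF ideal_sliced_ideal])
    \<comment> \<open>\<open>f\<close> may be inhomogeneous; gradedness allows passing to the cubic
      part of the product.\<close>
    then have "ext_part 3 (ext_mult (b j) f) \<in> ?J"
      using graded_sliced_ideal unfolding graded_ideal_def ext_part_def by blast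
    moreover have "ext_part 3 (ext_mult (b j) f) \<in> ext_comp 6 3"
      by (intro ext_part_comp ext_mult_closed fc ext_comp_carrier[OF b_comp[OF j6]])
    ultimately have 0: "ext_part 3 (ext_mult (b j) f) ?U = 0" using sliced_ideal_cubic by blast
    let ?T = "{T. T \<subseteq> {..<6} \<and> card T = card M \<and> T \<noteq> M}"
    have "ext_part 3 (ext_mult (b j) f) = ext_mult (b j) (ext_part 2 f)"
      using ext_part_linear_mult(1)[OF b_comp[OF j6], of 2 f] by (simp add: numeral_eq_Suc)
    also have "\<dots> = ext_scale (c M) (ext_mult (b j) (cmono M)) +
        (\<Sum>T\<in>?T. ext_scale (c T) (ext_mult (b j) (cmono T)))"
      using leads_part[OF f(2)] M2
      by (simp add: ext_mult_add_right ext_mult_sum_right ext_mult_scale_right)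
    finally have "ext_part 3 (ext_mult (b j) f) ?U = c M * ext_mult (b j) (cmono M) ?U +
        (\<Sum>T\<in>?T. c T * ext_mult (b j) (cmono T) ?U)"
      by (simp add: ext_apply sum_fun_apply)
    \<comment> \<open>Multiplication by b_j either kills the monomial of \<open>T\<close> or, by
      compatibility of the order, sends it below \<open>S0\<close>, where the functional is
      0.\<close>
    also have "(\<Sum>T\<in>?T. c T * ext_mult (b j) (cmono T) ?U) = 0"
    proof (rule sum.neutral, rule ballI)
      fix T assume T: "T \<in> ?T"
      show "c T * ext_mult (b j) (cmono T) ?U = 0"
      proof (cases "c T = 0 \<or> j \<in> T")
        case True
        then show ?thesis using T b_cmono_mem[of T j] by (auto simp: ext_apply)
      next
        case False
        then have "(T, M) \<in> r" using T f(2) by (auto simp: leads_def)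
        then have ins: "(insert j T, S0) \<in> r" "insert j T \<noteq> S0"
          using order_insert[of T M j] T M6 j6 False j(2) S0_eq by auto
        have "insert j T \<in> ?A" using T False j6 M2 finite_vars[of T] by auto
        then have "cmono (insert j T) ?U = 0" using ins by (rule below)
        moreover obtain e where "ext_mult (b j) (cmono T) = ext_scale e (cmono (insert j T))"
          using b_cmono[of T j] T False j6 by auto
        ultimately show ?thesis by (simp add: ext_apply)
      qed
    qed
    finally have "c M * ext_mult (b j) (cmono M) ?U = 0" using 0 by simp
    moreover obtain e where "e \<noteq> 0" "ext_mult (b j) (cmono M) = ext_scale e (cmono S0)"
      using b_cmono[OF M6 j6 j(2)] S0_eq by metis
    ultimately show False using S0(2) f(2) by (auto simp: ext_apply leads_def)
  qed

  let ?T = "{T. T \<subseteq> {..<6} \<and> (\<exists>M\<in>N. M \<subseteq> T) \<and> card T = 3}"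
  have leading: "cmono S \<in> ext_vs.span (cmono ` ?T)" if S: "S \<in> ?A" "S \<noteq> S0" for S
  proof -
    \<comment> \<open>Chosen so that the functional vanishes on \<open>?f\<close>, which puts
      \<open>?f\<close> into the ideal.\<close>
    define c where "c = - cmono S ?U / cmono S0 ?U"
    let ?f = "cmono S + ext_scale c (cmono S0)"
    have "cmono S \<in> ext_comp 6 3" "cmono S0 \<in> ext_comp 6 3"
      using cmono_comp[of S] cmono_comp[of S0] S S0(1) by auto
    then have "?f \<in> ext_comp 6 3"
      by (intro ext_comp_add ext_comp_scale)
    moreover have "?f ?U = 0" using S0(2) by (simp add: c_def ext_apply)
    ultimately have fJ: "?f \<in> ?J" using sliced_ideal_cubic by blast
    have S6: "S \<subseteq> {..<6}" "S0 \<subseteq> {..<6}" using S S0(1) by auto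
    \<comment> \<open>A nonzero \<open>c\<close> means that the functional is nonzero at
      \<open>S\<close>, and by minimality \<open>S\<close> is then not below
      \<open>S0\<close>.\<close>
    have "(S0, S) \<in> r" if "c \<noteq> 0"
    proof -
      have "(S, S0) \<notin> r" using that below[OF S(1) _ S(2)] by (auto simp: c_def)
      then show ?thesis using order_total[OF S6 S(2)] by simp
    qed
    then have "leads S ?f (\<lambda>U. if U = S then 1 else if U = S0 then c else 0)"
      using S6 S(2) by (rule leads_cmono_diff[rotated 3])
    then have "leading_term 6 b r ?f (ext_scale 1 (cmono S))"
      unfolding leading_term_iff by (intro exI conjI) (assumption, simp)
    then have "leading_term 6 b r ?f (cmono S)" by simp
    then have "cmono S \<in> lt_ideal 6 b r ?J" using fJ unfolding lt_ideal_def genideal_def by blast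
    \<comment> \<open>Here the Groebner basis enters: a cubic leading monomial already lies in the
      ideal of leading terms of quadrics.\<close>
    then have "cmono S \<in> lt_ideal 6 b r G" using G(1) by (simp add: groebner_basis_def)
    then show ?thesis
      using quadratic_lt_ideal[of G ?J 2 S 3] G S unfolding N_def groebner_basis_def by auto
  qed
  \<comment> \<open>If a second triple contained no member of \<open>N\<close>, then
    \<open>S0\<close> and the triples in \<open>?T\<close> would be at most 19, yet their monomials
    span the cubics, of dimension 20.\<close>
  have unique: "S = S0" if S: "S \<in> ?A" "\<not> (\<exists>M\<in>N. M \<subseteq> S)" for S
  proof (rule ccontr)
    assume ne: "S \<noteq> S0"
    have "cmono ` ?A \<subseteq> ext_vs.span (cmono ` insert S0 ?T)"
    proof (rule image_subsetI)
      fix T assume T: "T \<in> ?A"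
      show "cmono T \<in> ext_vs.span (cmono ` insert S0 ?T)"
      proof (cases "T = S0")
        case False
        then show ?thesis
          using leading[OF T] ext_vs.span_mono[of "cmono ` ?T" "cmono ` insert S0 ?T"] by auto
      qed (auto intro: ext_vs.span_base)
    qed
    then have "ext_vs.span (cmono ` ?A) \<subseteq> ext_vs.span (cmono ` insert S0 ?T)"
      by (rule ext_vs.span_minimal[OF _ ext_vs.subspace_span])
    then have "6 choose 3 \<le> card (cmono ` insert S0 ?T)"
      using ext_comp_span_cmono[of 3] finite_degree
      by (intro card_spanning_ext_comp) auto
    also have "\<dots> \<le> card (insert S0 ?T)" using finite_degree by (intro card_image_le) auto
    also have "\<dots> \<le> card (?A - {S})"
      using S S0(1) ne finite_degree[of "\<lambda>S. card S = 3"] by (intro card_mono) auto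
    also have "\<dots> = 19" using S(1) cardA by (subst card_Diff_singleton) auto
    finally show False by (simp add: numeral_eq_Suc)
  qed
  have "{T. T \<subseteq> {..<6} \<and> card T = 3 \<and> \<not> (\<exists>M\<in>N. M \<subseteq> T)} = {S0}"
    using unique S0(1) S0_standard by blast
  then have "card {S. S \<subseteq> {..<6::nat} \<and> card S = 2 \<and> S \<notin> N} \<le> 8"
    by (intro triangle_count) (auto simp: N_def leading_sets_def)
  \<comment> \<open>Bounding by the length of a list avoids showing that the six quadrics are
    distinct.\<close>
  moreover have "card (sliced_quadrics :: 'k ext set) \<le> 6"
    using card_length[of "[ext_mono {0, 1}, ext_mono {1, 2}, ext_mono {2, 3}, ext_mono {3, 4},
      ext_mono {4, 5}, ext_mono {0, 5} + ext_mono {3, 5} :: 'k ext]"]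
    by (simp add: sliced_quadrics_def)
  moreover have "6 choose 2 \<le> card {S. S \<subseteq> {..<6::nat} \<and> card S = 2 \<and> S \<notin> N} +
      card (sliced_quadrics :: 'k ext set)"
    unfolding N_def using graded_sliced_ideal sliced_ideal_quadratic
    by (intro card_standard_monomials) (simp_all add: sliced_quadrics_def)
  \<comment> \<open>The bounds combine to 15 \<le> 8 + 6.\<close>
  ultimately show False by (simp add: numeral_eq_Suc)
qed

theorem theorem4p5:
  shows "\<exists>(n :: nat) (J :: 'k::field ext set).
    graded_ideal n J \<and> J \<inter> ext_comp n 1 \<subseteq> {\<zero>\<^bsub>ext_alg n\<^esub>} \<and>
    LG_quadratic n J \<and> \<not> G_quadratic n J"
  using graded_sliced_ideal sliced_ideal_linear LG_quadratic_sliced_ideal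
    not_G_quadratic_sliced_ideal
  by (intro exI[of _ 6] exI[of _ sliced_ideal]) simp

end
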